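(* Let $C(z)\in\operatorname{Hom}(V^{\pi_1}\otimes V^{\pi},V^{\pi}\otimes V^{\pi_2})$ be an $(\check R_1,\check R_2)$ intertwiner with spectral parameter, and suppose there exists $C^{-1}(z)\in\operatorname{Hom}(V^\pi\otimes V^{\pi_2},V^{\pi_1}\otimes V^\pi)$ with $C(z)C^{-1}(z)=\mathrm{id}_{V^\pi\otimes V^{\pi_2}}$ and $C^{-1}(z)C(z)=\mathrm{id}_{V^{\pi_1}\otimes V^\pi}$. Then $$\overline{\operatorname{tr}}_{V^{\pi_1}}\check R_1(z)*_{\pi_1}\overline{\operatorname{tr}}_{V^{\pi}}C(z')=\overline{\operatorname{tr}}_{V^{\pi}}C(z')*_{\pi_2}\overline{\operatorname{tr}}_{V^{\pi_2}}\check R_2(z),$$ that is, for all $a\in\mathrm{Ob}(\pi_1)$, $b\in\mathrm{Ob}(\pi_2)$, $$\sum_{(\alpha',\beta')}\big(\overline{\operatorname{tr}}_{V^\pi}C(z')\big)(\beta')\circ\big(\overline{\operatorname{tr}}_{V^{\pi_1}}\check R_1(z)\big)(\alpha')=\sum_{(\beta'',\gamma')}\big(\overline{\operatorname{tr}}_{V^{\pi_2}}\check R_2(z)\big)(\gamma')\circ\big(\overline{\operatorname{tr}}_{V^\pi}C(z')\big)(\beta'')$$ as maps (meromorphic in $z,z'$) $\bigoplus_{\alpha\in\pi_1(a,a)}V^{\pi_1}_\alpha\to\bigoplus_{\gamma\in\pi_2(b,b)}V^{\pi_2}_\gamma$, where the left sum is over $\alpha'\in\pi_1,\beta'\in\pi$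 with $s(\alpha')=a$, $t(\alpha')=s_\pi(\beta')$, $t_\pi(\beta')=b$, and the right sum over $\beta''\in\pi,\gamma'\in\pi_2$ with $s_\pi(\beta'')=a$, $t_\pi(\beta'')=s(\gamma')$, $t(\gamma')=b$.
   Context: The ground field is $k=\mathbb C$. In a groupoid $\pi$, $\eta\circ\gamma$ means $\gamma$ followed by $\eta$; $s,t$ are source and target; $\pi(a,b)$ is the set of arrows from $a$ to $b$. A $\pi$-graded vector space of finite type is a family $V=(V_\alpha)_{\alpha\in\pi}$ of finite dimensional spaces indexed by the arrows such that for each object $a$ only finitely many arrows $\alpha$ with source or target $a$ have $V_\alpha\neq0$; $(V\otimes W)_\gamma=\bigoplus_{\beta\circ\alpha=\gamma}V_\alpha\otimes W_\beta$, and $\operatorname{End}(V\otimes V)$ consists of degree-preserving linear maps. A Yang--Baxter operator on $V$ is a meromorphic function $z\mapsto\check R(z)\in\operatorname{End}(V\otimes V)$ with $\check R(z-w)^{(23)}\check R(z)^{(12)}\check R(w)^{(23)}=\check R(w)^{(12)}\check R(z)^{(23)}\check R(z-w)^{(12)}$ and $\check R(z)\check R(-z)=\mathrm{id}$. Superscripts $(i\,i{+}1)$ indicate the tensor factors acted on. For $i=1,2$ let $\pi_i$ be a groupoid, $V^{\pi_i}$ a $\pi_i$-graded vector space of finite type, $\check R_i(z)$ a Yang--Baxter operator on $V^{\pi_i}$. A connecting set is a set $\pi$ with surjective maps $s_\pi:\pi\to\mathrm{Ob}(\pi_1)$, $t_\pi:\pi\to\mathrm{Ob}(\pi_2)$ (elements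 are viewed as arrows from $\pi_1$ to $\pi_2$), and $V^\pi=(V^\pi_\beta)_{\beta\in\pi}$ is a family of finite dimensional spaces, only finitely many being nonzero among those with a given source or a given target. Tensor products are direct sums over composable strings of arrows ($V^{\pi_1}\otimes V^\pi=\bigoplus_{t(\alpha)=s_\pi(\beta)}V^{\pi_1}_\alpha\otimes V^\pi_\beta$, etc.), and $\operatorname{Hom}$ between them denotes linear maps preserving the source (in $\mathrm{Ob}(\pi_1)$) and target (in $\mathrm{Ob}(\pi_2)$) of strings. An $(\check R_1,\check R_2)$ intertwiner with spectral parameter is a (meromorphic) function $z\mapsto C(z)\in\operatorname{Hom}(V^{\pi_1}\otimes V^{\pi},V^{\pi}\otimes V^{\pi_2})$ with $$C(w)^{(12)}C(z)^{(23)}\check R_1(z-w)^{(12)}=\check R_2(z-w)^{(23)}C(z)^{(12)}C(w)^{(23)}\quad\text{on }V^{\pi_1}\otimes V^{\pi_1}\otimes V^\pi .$$ Partial traces: for $\beta\in\pi$ with $s_\pi(\beta)=a$, $t_\pi(\beta)=b$, $\alpha\in\pi_1(a,a)$, $\gamma\in\pi_2(b,b)$, let $C(\beta,\alpha,\gamma):V^{\pi_1}_\alpha\otimes V^\pi_\beta\to V^\pi_\beta\otimes V^{\pi_2}_\gamma$ be the corresponding component of $C=C(z')$. With a basis $(e_{i,\beta})$ of $V^\pi_\beta$ and dual basis $(e^*_{i,\beta})$, $(\overline{\operatorname{tr}}_{V^\pi}C)(\beta):\bigoplus_{\alpha\in\pi_1(a,a)}V^{\pi_1}_\alpha\to\bigoplus_{\gamma\in\pi_2(b,b)}V^{\pi_2}_\gamma$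 has components $\sum_i(e^*_{i,\beta}\otimes\mathrm{id})\,C(\beta,\alpha,\gamma)\,(\mathrm{id}\otimes e_{i,\beta})$. The partial traces $(\overline{\operatorname{tr}}_{V^{\pi_i}}\check R_i(z))(\alpha')$, $\alpha'\in\pi_i(a,a')$, are defined in the same way from the components $V^{\pi_i}_{\alpha}\otimes V^{\pi_i}_{\alpha'}\to V^{\pi_i}_{\alpha'}\otimes V^{\pi_i}_{\alpha''}$ of $\check R_i(z)$ ($\alpha\in\pi_i(a,a)$, $\alpha''\in\pi_i(a',a')$), tracing over $V^{\pi_i}_{\alpha'}$. *)

theory Defs
  imports "HOL-Complex_Analysis.Complex_Analysis" "HOL-Library.Function_Algebras"
begin

section \<open>Groupoids and connecting sets\<close>

record ('o, 'p, 'e) arrows =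
  Arr :: "'e set"
  src :: "'e \<Rightarrow> 'o"
  tgt :: "'e \<Rightarrow> 'p"

text \<open>\<open>comp \<pi> \<eta> \<gamma>\<close> is \<open>\<gamma>\<close> followed by \<open>\<eta>\<close>.\<close>

record ('o, 'e) groupoid = "('o, 'o, 'e) arrows" +
  Ob :: "'o set"
  comp :: "'e \<Rightarrow> 'e \<Rightarrow> 'e"
  ident :: "'o \<Rightarrow> 'e"

definition is_groupoid :: "('o, 'e) groupoid \<Rightarrow> bool" where
  "is_groupoid \<pi> \<longleftrightarrow>
     (\<forall>\<alpha>\<in>Arr \<pi>. src \<pi> \<alpha> \<in> Ob \<pi> \<and> tgt \<pi> \<alpha> \<in> Ob \<pi>) \<and>
     (\<forall>\<alpha>\<in>Arr \<pi>. \<forall>\<beta>\<in>Arr \<pi>. tgt \<pi> \<alpha> = src \<pi> \<beta> \<longrightarrow>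
        comp \<pi> \<beta> \<alpha> \<in> Arr \<pi> \<and> src \<pi> (comp \<pi> \<beta> \<alpha>) = src \<pi> \<alpha> \<and> tgt \<pi> (comp \<pi> \<beta> \<alpha>) = tgt \<pi> \<beta>) \<and>
     (\<forall>\<alpha>\<in>Arr \<pi>. \<forall>\<beta>\<in>Arr \<pi>. \<forall>\<gamma>\<in>Arr \<pi>. tgt \<pi> \<alpha> = src \<pi> \<beta> \<and> tgt \<pi> \<beta> = src \<pi> \<gamma> \<longrightarrow>
        comp \<pi> \<gamma> (comp \<pi> \<beta> \<alpha>) = comp \<pi> (comp \<pi> \<gamma> \<beta>) \<alpha>) \<and>
     (\<forall>a\<in>Ob \<pi>. ident \<pi> a \<in> Arr \<pi> \<and> src \<pi> (ident \<pi> a) = a \<and> tgt \<pi> (ident \<pi> a) = a) \<and>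
     (\<forall>\<alpha>\<in>Arr \<pi>. comp \<pi> \<alpha> (ident \<pi> (src \<pi> \<alpha>)) = \<alpha> \<and> comp \<pi> (ident \<pi> (tgt \<pi> \<alpha>)) \<alpha> = \<alpha>) \<and>
     (\<forall>\<alpha>\<in>Arr \<pi>. \<exists>\<beta>\<in>Arr \<pi>. src \<pi> \<beta> = tgt \<pi> \<alpha> \<and> tgt \<pi> \<beta> = src \<pi> \<alpha> \<and>
        comp \<pi> \<beta> \<alpha> = ident \<pi> (src \<pi> \<alpha>) \<and> comp \<pi> \<alpha> \<beta> = ident \<pi> (tgt \<pi> \<alpha>))"

definition connecting_set ::
  "('o, 'e1) groupoid \<Rightarrow> ('p, 'e2) groupoid \<Rightarrow> ('o, 'p, 'e) arrows \<Rightarrow> bool" where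
  "connecting_set \<pi>1 \<pi>2 \<pi> \<longleftrightarrow> src \<pi> ` Arr \<pi> = Ob \<pi>1 \<and> tgt \<pi> ` Arr \<pi> = Ob \<pi>2"


section \<open>Families of vector spaces indexed by arrows\<close>

text \<open>
  The spaces of a family are subspaces of one ambient complex vector space. This is no loss of
  generality: any family embeds into its direct sum.
\<close>

record ('e, 'v) vfamily =
  scal :: "complex \<Rightarrow> 'v \<Rightarrow> 'v"
  fib :: "'e \<Rightarrow> 'v set"

definition finite_type ::
  "('o, 'p, 'e, 'm) arrows_scheme \<Rightarrow> ('e, 'v::ab_group_add) vfamily \<Rightarrow> bool" where
  "finite_type \<pi> V \<longleftrightarrow>
     vector_space (scal V) \<and>
     (\<forall>\<alpha>\<in>Arr \<pi>. module.subspace (scal V) (fib V \<alpha>) \<and>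
        (\<exists>B. finite B \<and> module.span (scal V) B = fib V \<alpha>)) \<and>
     (\<forall>a. finite {\<alpha> \<in> Arr \<pi>. src \<pi> \<alpha> = a \<and> fib V \<alpha> \<noteq> {0}}) \<and>
     (\<forall>b. finite {\<alpha> \<in> Arr \<pi>. tgt \<pi> \<alpha> = b \<and> fib V \<alpha> \<noteq> {0}})"


section \<open>Tensor products\<close>

text \<open>
  For finite dimensional spaces \<open>U\<^sub>1 \<otimes> \<dots> \<otimes> U\<^sub>n\<close> is realised as the space of \<open>n\<close>-linear forms on
  \<open>U\<^sub>1\<^sup>* \<times> \<dots> \<times> U\<^sub>n\<^sup>*\<close>, the pure tensor \<open>u\<^sub>1 \<otimes> \<dots> \<otimes> u\<^sub>n\<close> being \<open>(f\<^sub>1, \<dots>, f\<^sub>n) \<mapsto> f\<^sub>1 u\<^sub>1 \<cdots> f\<^sub>n u\<^sub>n\<close>.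
  For \<open>n = 1\<close> this is the identification of \<open>U\<close> with its bidual. All forms are extended by zero
  outside of the spaces on which they live, so that equality of forms is equality of functions.
\<close>

type_synonym 'v covec = "'v \<Rightarrow> complex"

definition dual :: "(complex \<Rightarrow> 'v::ab_group_add \<Rightarrow> 'v) \<Rightarrow> 'v set \<Rightarrow> 'v covec set" where
  "dual s U = {f. (\<forall>u\<in>U. \<forall>v\<in>U. f (u + v) = f u + f v) \<and> (\<forall>c. \<forall>u\<in>U. f (s c u) = c * f u) \<and>
                  (\<forall>u. u \<notin> U \<longrightarrow> f u = 0)}"

definition bidual ::
  "(complex \<Rightarrow> 'v::ab_group_add \<Rightarrow> 'v) \<Rightarrow> 'v set \<Rightarrow> ('v covec \<Rightarrow> complex) set" where
  "bidual s U = dual (\<lambda>c f v. c * f v) (dual s U)"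

text \<open>
  An element of \<open>V \<otimes> W = \<Oplus> V\<^sub>\<alpha> \<otimes> W\<^sub>\<beta>\<close> is the function sending the string \<open>\<alpha>, \<beta>\<close> to its component
  in \<open>V\<^sub>\<alpha> \<otimes> W\<^sub>\<beta>\<close>, and similarly for one and three factors. In strings the arrow that is
  followed first stands on the left.
\<close>

type_synonym ('a, 'u) ten1 = "'a \<Rightarrow> 'u covec \<Rightarrow> complex"
type_synonym ('a, 'u, 'b, 'v) ten2 = "'a \<Rightarrow> 'b \<Rightarrow> 'u covec \<Rightarrow> 'v covec \<Rightarrow> complex"
type_synonym ('a, 'u, 'b, 'v, 'c, 'w) ten3 =
  "'a \<Rightarrow> 'b \<Rightarrow> 'c \<Rightarrow> 'u covec \<Rightarrow> 'v covec \<Rightarrow> 'w covec \<Rightarrow> complex"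

definition loops :: "('o, 'o, 'a, 'm) arrows_scheme \<Rightarrow> 'o \<Rightarrow> 'a set" where
  "loops \<pi> a = {\<alpha> \<in> Arr \<pi>. src \<pi> \<alpha> = a \<and> tgt \<pi> \<alpha> = a}"

text \<open>\<open>loop_space \<pi> U a\<close> is the direct sum of the \<open>U\<^sub>\<alpha>\<close> over \<open>\<alpha> \<in> \<pi>(a, a)\<close>.\<close>

definition loop_space ::
  "('o, 'o, 'a, 'm) arrows_scheme \<Rightarrow> ('a, 'u::ab_group_add) vfamily \<Rightarrow> 'o \<Rightarrow> ('a, 'u) ten1 set" where
  "loop_space \<pi> U a = {x.
     (\<forall>\<alpha>. if \<alpha> \<in> loops \<pi> a then x \<alpha> \<in> bidual (scal U) (fib U \<alpha>) else x \<alpha> = 0) \<and>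
     finite {\<alpha>. x \<alpha> \<noteq> 0}}"

definition tensor2 ::
  "('o, 'p, 'a, 'm) arrows_scheme \<Rightarrow> ('a, 'u::ab_group_add) vfamily \<Rightarrow>
   ('p, 'q, 'b, 'n) arrows_scheme \<Rightarrow> ('b, 'v::ab_group_add) vfamily \<Rightarrow> ('a, 'u, 'b, 'v) ten2 set" where
  "tensor2 \<pi> U \<rho> V = {x.
     (\<forall>\<alpha> \<beta>. if \<alpha> \<in> Arr \<pi> \<and> \<beta> \<in> Arr \<rho> \<and> tgt \<pi> \<alpha> = src \<rho> \<beta>
        then (\<forall>g. (\<lambda>f. x \<alpha> \<beta> f g) \<in> bidual (scal U) (fib U \<alpha>)) \<and>
             (\<forall>f. (\<lambda>g. x \<alpha> \<beta> f g) \<in> bidual (scal V) (fib V \<beta>))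
        else x \<alpha> \<beta> = 0) \<and>
     finite {(\<alpha>, \<beta>). x \<alpha> \<beta> \<noteq> 0}}"

definition tensor3 ::
  "('o, 'p, 'a, 'm) arrows_scheme \<Rightarrow> ('a, 'u::ab_group_add) vfamily \<Rightarrow>
   ('p, 'q, 'b, 'n) arrows_scheme \<Rightarrow> ('b, 'v::ab_group_add) vfamily \<Rightarrow>
   ('q, 'r, 'c, 'k) arrows_scheme \<Rightarrow> ('c, 'w::ab_group_add) vfamily \<Rightarrow>
   ('a, 'u, 'b, 'v, 'c, 'w) ten3 set" where
  "tensor3 \<pi> U \<rho> V \<sigma> W = {x.
     (\<forall>\<alpha> \<beta> \<gamma>. if \<alpha> \<in> Arr \<pi> \<and> \<beta> \<in> Arr \<rho> \<and> \<gamma> \<in> Arr \<sigma> \<and> tgt \<pi> \<alpha> = src \<rho> \<beta> \<and> tgt \<rho> \<beta> = src \<sigma> \<gamma>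
        then (\<forall>g h. (\<lambda>f. x \<alpha> \<beta> \<gamma> f g h) \<in> bidual (scal U) (fib U \<alpha>)) \<and>
             (\<forall>f h. (\<lambda>g. x \<alpha> \<beta> \<gamma> f g h) \<in> bidual (scal V) (fib V \<beta>)) \<and>
             (\<forall>f g. (\<lambda>h. x \<alpha> \<beta> \<gamma> f g h) \<in> bidual (scal W) (fib W \<gamma>))
        else x \<alpha> \<beta> \<gamma> = 0) \<and>
     finite {(\<alpha>, \<beta>, \<gamma>). x \<alpha> \<beta> \<gamma> \<noteq> 0}}"


section \<open>Operators\<close>

text \<open>
  Linear maps \<open>F\<close> from \<open>X\<close> to \<open>Y\<close> such that an element all of whose strings have degree \<open>g\<close> is
  sent to an element all of whose strings have degree \<open>g\<close>. Outside of \<open>X\<close> nothing is required.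
\<close>

definition graded_maps ::
  "('a, 'u, 'b, 'v) ten2 set \<Rightarrow> ('a \<Rightarrow> 'b \<Rightarrow> 'g) \<Rightarrow> ('c, 'w, 'd, 'y) ten2 set \<Rightarrow> ('c \<Rightarrow> 'd \<Rightarrow> 'g) \<Rightarrow>
   (('a, 'u, 'b, 'v) ten2 \<Rightarrow> ('c, 'w, 'd, 'y) ten2) set" where
  "graded_maps X dX Y dY = {F.
     (\<forall>x\<in>X. F x \<in> Y) \<and>
     (\<forall>c. \<forall>x\<in>X. \<forall>y\<in>X. F (\<lambda>\<alpha> \<beta> f g. c * x \<alpha> \<beta> f g + y \<alpha> \<beta> f g) =
                          (\<lambda>\<alpha> \<beta> f g. c * F x \<alpha> \<beta> f g + F y \<alpha> \<beta> f g)) \<and>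
     (\<forall>d. \<forall>x\<in>X. (\<forall>\<alpha> \<beta>. x \<alpha> \<beta> \<noteq> 0 \<longrightarrow> dX \<alpha> \<beta> = d) \<longrightarrow> (\<forall>\<alpha> \<beta>. F x \<alpha> \<beta> \<noteq> 0 \<longrightarrow> dY \<alpha> \<beta> = d))}"

definition End2 ::
  "('o, 'a) groupoid \<Rightarrow> ('a, 'u::ab_group_add) vfamily \<Rightarrow>
   (('a, 'u, 'a, 'u) ten2 \<Rightarrow> ('a, 'u, 'a, 'u) ten2) set" where
  "End2 \<pi> V = graded_maps (tensor2 \<pi> V \<pi> V) (\<lambda>\<alpha> \<beta>. comp \<pi> \<beta> \<alpha>) (tensor2 \<pi> V \<pi> V) (\<lambda>\<alpha> \<beta>. comp \<pi> \<beta> \<alpha>)"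

text \<open>\<open>Hom2 \<pi> U \<rho> V \<pi>' U' \<rho>' V'\<close> is \<open>Hom(U \<otimes> V, U' \<otimes> V')\<close>.\<close>

definition Hom2 ::
  "('o, 'p, 'a, 'm) arrows_scheme \<Rightarrow> ('a, 'u::ab_group_add) vfamily \<Rightarrow>
   ('p, 'q, 'b, 'n) arrows_scheme \<Rightarrow> ('b, 'v::ab_group_add) vfamily \<Rightarrow>
   ('o, 'r, 'c, 'k) arrows_scheme \<Rightarrow> ('c, 'w::ab_group_add) vfamily \<Rightarrow>
   ('r, 'q, 'd, 'l) arrows_scheme \<Rightarrow> ('d, 'y::ab_group_add) vfamily \<Rightarrow>
   (('a, 'u, 'b, 'v) ten2 \<Rightarrow> ('c, 'w, 'd, 'y) ten2) set" where
  "Hom2 \<pi> U \<rho> V \<pi>' U' \<rho>' V' =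
     graded_maps (tensor2 \<pi> U \<rho> V) (\<lambda>\<alpha> \<beta>. (src \<pi> \<alpha>, tgt \<rho> \<beta>))
                 (tensor2 \<pi>' U' \<rho>' V') (\<lambda>\<alpha> \<beta>. (src \<pi>' \<alpha>, tgt \<rho>' \<beta>))"

definition op12 ::
  "(('a, 'u, 'b, 'v) ten2 \<Rightarrow> ('c, 'w, 'd, 'y) ten2) \<Rightarrow>
   ('a, 'u, 'b, 'v, 'e, 'z) ten3 \<Rightarrow> ('c, 'w, 'd, 'y, 'e, 'z) ten3" where
  "op12 F x = (\<lambda>\<alpha> \<beta> \<gamma> f g h. F (\<lambda>\<alpha>' \<beta>' f' g'. x \<alpha>' \<beta>' \<gamma> f' g' h) \<alpha> \<beta> f g)"

definition op23 ::
  "(('a, 'u, 'b, 'v) ten2 \<Rightarrow> ('c, 'w, 'd, 'y) ten2) \<Rightarrow>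
   ('e, 'z, 'a, 'u, 'b, 'v) ten3 \<Rightarrow> ('e, 'z, 'c, 'w, 'd, 'y) ten3" where
  "op23 F x = (\<lambda>\<alpha> \<beta> \<gamma> f g h. F (\<lambda>\<beta>' \<gamma>' g' h'. x \<alpha> \<beta>' \<gamma>' f g' h') \<beta> \<gamma> g h)"


section \<open>Meromorphic families of operators\<close>

text \<open>
  Meromorphic means that all matrix coefficients are meromorphic. The value at a pole is an
  arbitrary element of the operator space \<open>H\<close>.
\<close>

definition meromorphic_family ::
  "('a, 'u, 'b, 'v) ten2 set \<Rightarrow> (('a, 'u, 'b, 'v) ten2 \<Rightarrow> ('c, 'w, 'd, 'y) ten2) set \<Rightarrow>
   (complex \<Rightarrow> ('a, 'u, 'b, 'v) ten2 \<Rightarrow> ('c, 'w, 'd, 'y) ten2) \<Rightarrow> bool" where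
  "meromorphic_family X H F \<longleftrightarrow>
     (\<forall>z. F z \<in> H) \<and> (\<forall>x\<in>X. \<forall>\<alpha> \<beta> f g. (\<lambda>z. F z x \<alpha> \<beta> f g) meromorphic_on UNIV)"

text \<open>
  Identities between meromorphic functions of one or two variables do not refer to the values at
  poles. They mean agreement on a dense open set of parameters, hence wherever
  no factor has a singularity. As there may be infinitely many objects, the poles of
  different matrix coefficients need not lie in a common discrete set; therefore the dense open set
  may depend on the vector \<open>x\<close> to which the operators are applied.
\<close>

definition generically :: "('p::topological_space \<Rightarrow> bool) \<Rightarrow> bool" where
  "generically P \<longleftrightarrow> (\<exists>U. open U \<and> closure U = UNIV \<and> (\<forall>p\<in>U. P p))"

definition mero_eq :: "'x set \<Rightarrow> ('p::topological_space \<Rightarrow> 'x \<Rightarrow> 'y) \<Rightarrow> ('p \<Rightarrow> 'x \<Rightarrow> 'y) \<Rightarrow> bool" where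
  "mero_eq X F G \<longleftrightarrow> (\<forall>x\<in>X. generically (\<lambda>p. F p x = G p x))"

definition yang_baxter_operator ::
  "('o, 'a) groupoid \<Rightarrow> ('a, 'u::ab_group_add) vfamily \<Rightarrow>
   (complex \<Rightarrow> ('a, 'u, 'a, 'u) ten2 \<Rightarrow> ('a, 'u, 'a, 'u) ten2) \<Rightarrow> bool" where
  "yang_baxter_operator \<pi> V R \<longleftrightarrow>
     meromorphic_family (tensor2 \<pi> V \<pi> V) (End2 \<pi> V) R \<and>
     mero_eq (tensor3 \<pi> V \<pi> V \<pi> V)
       (\<lambda>(z, w). op23 (R (z - w)) \<circ> op12 (R z) \<circ> op23 (R w))
       (\<lambda>(z, w). op12 (R w) \<circ> op23 (R z) \<circ> op12 (R (z - w))) \<and>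
     mero_eq (tensor2 \<pi> V \<pi> V) (\<lambda>z. R z \<circ> R (- z)) (\<lambda>z. id)"

definition intertwiner ::
  "('o, 'a) groupoid \<Rightarrow> ('a, 'u::ab_group_add) vfamily \<Rightarrow>
   ('p, 'b) groupoid \<Rightarrow> ('b, 'v::ab_group_add) vfamily \<Rightarrow>
   ('o, 'p, 'e) arrows \<Rightarrow> ('e, 'w::ab_group_add) vfamily \<Rightarrow>
   (complex \<Rightarrow> ('a, 'u, 'a, 'u) ten2 \<Rightarrow> ('a, 'u, 'a, 'u) ten2) \<Rightarrow>
   (complex \<Rightarrow> ('b, 'v, 'b, 'v) ten2 \<Rightarrow> ('b, 'v, 'b, 'v) ten2) \<Rightarrow>
   (complex \<Rightarrow> ('a, 'u, 'e, 'w) ten2 \<Rightarrow> ('e, 'w, 'b, 'v) ten2) \<Rightarrow> bool" where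
  "intertwiner \<pi>1 V1 \<pi>2 V2 \<pi> V R1 R2 C \<longleftrightarrow>
     meromorphic_family (tensor2 \<pi>1 V1 \<pi> V) (Hom2 \<pi>1 V1 \<pi> V \<pi> V \<pi>2 V2) C \<and>
     mero_eq (tensor3 \<pi>1 V1 \<pi>1 V1 \<pi> V)
       (\<lambda>(z, w). op12 (C w) \<circ> op23 (C z) \<circ> op12 (R1 (z - w)))
       (\<lambda>(z, w). op23 (R2 (z - w)) \<circ> op12 (C z) \<circ> op23 (C w))"


section \<open>Partial traces and their convolution\<close>

definition basis_of :: "(complex \<Rightarrow> 'v::ab_group_add \<Rightarrow> 'v) \<Rightarrow> 'v set \<Rightarrow> 'v set" where
  "basis_of s U = (SOME B. \<not> module.dependent s B \<and> module.span s B = U)"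

text \<open>\<open>x \<otimes> e\<close> for \<open>e\<close> in the component of degree \<open>\<beta>\<close> of \<open>W\<close>\<close>

definition tensor_vec ::
  "('a, 'u) ten1 \<Rightarrow> ('b, 'w::ab_group_add) vfamily \<Rightarrow> 'b \<Rightarrow> 'w \<Rightarrow> ('a, 'u, 'b, 'w) ten2" where
  "tensor_vec x W \<beta> e =
     (\<lambda>\<alpha> \<beta>' f g. if \<beta>' = \<beta> \<and> g \<in> dual (scal W) (fib W \<beta>) then x \<alpha> f * g e else 0)"

text \<open>
  The operator \<open>F\<close> maps \<open>U \<otimes> W\<close> to \<open>W \<otimes> V\<close>, where \<open>W\<close> is indexed by \<open>\<rho>\<close> and \<open>V\<close> by \<open>\<sigma>\<close>. The dual
  basis vector of \<open>e\<close> sends a vector to its coefficient at \<open>e\<close>, given by \<open>representation\<close>, which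
  vanishes outside of the span of the basis.
\<close>

definition ptrace ::
  "('o, 'p, 'b, 'n) arrows_scheme \<Rightarrow> ('b, 'w::ab_group_add) vfamily \<Rightarrow> ('p, 'p, 'c, 'k) arrows_scheme \<Rightarrow>
   (('a, 'u, 'b, 'w) ten2 \<Rightarrow> ('b, 'w, 'c, 'v) ten2) \<Rightarrow> 'b \<Rightarrow> ('a, 'u) ten1 \<Rightarrow> ('c, 'v) ten1" where
  "ptrace \<rho> W \<sigma> F \<beta> x =
     (\<lambda>\<gamma> h. if \<gamma> \<in> loops \<sigma> (tgt \<rho> \<beta>)
        then (let B = basis_of (scal W) (fib W \<beta>) in
                \<Sum>e\<in>B. F (tensor_vec x W \<beta> e) \<beta> \<gamma> (\<lambda>v. module.representation (scal W) B v e) h)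
        else 0)"

text \<open>
  The component at \<open>(a, b)\<close> of the convolution product of \<open>S\<close> and \<open>T\<close>. There may be infinitely many
  strings from \<open>a\<close> to \<open>b\<close>, but only finitely many nonzero summands; the vanishing ones
  are left out explicitly because \<open>sum\<close> is zero over an infinite set.
\<close>

definition convolution ::
  "('o, 'p, 'a, 'm) arrows_scheme \<Rightarrow> ('p, 'q, 'b, 'n) arrows_scheme \<Rightarrow>
   ('a \<Rightarrow> 'x \<Rightarrow> 'y) \<Rightarrow> ('b \<Rightarrow> 'y \<Rightarrow> 'z::comm_monoid_add) \<Rightarrow> 'o \<Rightarrow> 'q \<Rightarrow> 'x \<Rightarrow> 'z" where
  "convolution \<pi> \<rho> S T a b x =
     (\<Sum>(\<alpha>, \<beta>) \<in> {(\<alpha>, \<beta>). \<alpha> \<in> Arr \<pi> \<and> \<beta> \<in> Arr \<rho> \<and> src \<pi> \<alpha> = a \<and> tgt \<pi> \<alpha> = src \<rho> \<beta> \<and> tgt \<rho> \<beta> = b \<and>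
                       T \<beta> (S \<alpha> x) \<noteq> 0}. T \<beta> (S \<alpha> x))"

end

theory Submission
  imports Defs
begin

text \<open>
  Both sides are traces of one endomorphism each, and the intertwining relation says that the
  two endomorphisms are conjugate.

  Fix objects \<open>a\<close>, \<open>b\<close>, a vector \<open>x\<close> in the sum of the \<open>V1\<^sub>\<alpha>\<close> over the loops at \<open>a\<close>, and a loop \<open>\<gamma>\<close> at \<open>b\<close>
  with a covector \<open>h\<close> on \<open>V2\<^sub>\<gamma>\<close>. Feeding \<open>x\<close> into the first factor and evaluating the last factor on \<open>h\<close>
  turns \<open>C(z')\<^sup>(\<^sup>2\<^sup>3\<^sup>) R1(z)\<^sup>(\<^sup>1\<^sup>2\<^sup>)\<close> into an endomorphism \<open>M\<close> of \<open>(V1 \<otimes> V)\<^sub>a\<^sub>b\<close>, the part of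
  \<open>V1 \<otimes> V\<close> with source \<open>a\<close> and target \<open>b\<close>, and \<open>R2(z)\<^sup>(\<^sup>2\<^sup>3\<^sup>) C(z')\<^sup>(\<^sup>1\<^sup>2\<^sup>)\<close> into an endomorphism \<open>N\<close> of
  \<open>(V \<otimes> V2)\<^sub>a\<^sub>b\<close>. Both spaces are finite dimensional by finite type. A partial trace followed by
  another one, summed over all strings from \<open>a\<close> to \<open>b\<close>, is a trace over the tensor product
  (\<open>convolution_ptrace\<close>); hence the two sides, applied to \<open>x\<close> and evaluated at \<open>\<gamma>\<close>, \<open>h\<close>, are \<open>tr M\<close> and
  \<open>tr N\<close>.

  Put \<open>w = z' - z\<close> and let \<open>D\<close> be the restriction of \<open>C(w)\<close> to \<open>(V1 \<otimes> V)\<^sub>a\<^sub>b \<rightarrow> (V \<otimes> V2)\<^sub>a\<^sub>b\<close>. With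
  the parameters \<open>(z', w)\<close> the intertwining relation reads
  \<open>C(w)\<^sup>(\<^sup>1\<^sup>2\<^sup>) C(z')\<^sup>(\<^sup>2\<^sup>3\<^sup>) R1(z)\<^sup>(\<^sup>1\<^sup>2\<^sup>) = R2(z)\<^sup>(\<^sup>2\<^sup>3\<^sup>) C(z')\<^sup>(\<^sup>1\<^sup>2\<^sup>) C(w)\<^sup>(\<^sup>2\<^sup>3\<^sup>)\<close>: the operator
  \<open>C(w)\<close> acts on the outgoing traced factors on the left and on the incoming ones on the right. So it is
  \<open>D \<circ> M = N \<circ> D\<close>, and \<open>tr M = tr N\<close> follows from the invertibility of \<open>D\<close> (\<open>convolution_commute\<close>).
  The matrices below have the index of the argument first, which reverses products.

  For each single value of the parameters this is linear algebra over a finite basis. The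
  relation for the product of \<open>x\<close> with each basis tensor and the inversion formulas on each basis
  tensor hold on dense open sets. There are finitely many of them, and their intersection, carried
  over by the linear substitution \<open>(z, z') \<mapsto> (z', z' - z)\<close>, is the dense open set on which the
  two sides agree at \<open>x\<close>.
\<close>

lemma sum_fun_apply: "(\<Sum>i\<in>I. f i) x = (\<Sum>i\<in>I. f i x)"
  by (induction I rule: infinite_finite_induct) auto

section \<open>Dual bases\<close>

lemma dual_sum:
  assumes f: "f \<in> dual s U" and z: "0 \<in> U" and add: "\<And>u v. u \<in> U \<Longrightarrow> v \<in> U \<Longrightarrow> u + v \<in> U"
    and sc: "\<And>c u. u \<in> U \<Longrightarrow> s c u \<in> U" and u: "\<And>i. i \<in> I \<Longrightarrow> u i \<in> U"
  shows "f (\<Sum>i\<in>I. s (c i) (u i)) = (\<Sum>i\<in>I. c i * f (u i))"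
proof -
  have "f (0 + 0) = f 0 + f 0" using f z unfolding dual_def by blast
  then have f0: "f 0 = 0" by simp
  have "(\<Sum>i\<in>I. s (c i) (u i)) \<in> U \<and> f (\<Sum>i\<in>I. s (c i) (u i)) = (\<Sum>i\<in>I. c i * f (u i))"
    using u
  proof (induction I rule: infinite_finite_induct)
    case (insert i I)
    then have "s (c i) (u i) \<in> U" "(\<Sum>i\<in>I. s (c i) (u i)) \<in> U" using sc by auto
    moreover have "f (s (c i) (u i)) = c i * f (u i)"
      using f insert.prems unfolding dual_def by blast
    moreover have "f (s (c i) (u i) + (\<Sum>i\<in>I. s (c i) (u i)))
       = f (s (c i) (u i)) + f (\<Sum>i\<in>I. s (c i) (u i))"
      using f calculation unfolding dual_def by blast
    ultimately show ?case using insert add by simp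
  qed (use f0 z in auto)
  then show ?thesis by blast
qed

lemma zero_in_dual: "(\<lambda>v. 0) \<in> dual s U"
  by (simp add: dual_def)

lemma dual_lincomb: "f \<in> dual s U \<Longrightarrow> g \<in> dual s U \<Longrightarrow> (\<lambda>v. c * f v + g v) \<in> dual s U"
  by (simp add: dual_def algebra_simps)

lemma dual_add: "f \<in> dual s U \<Longrightarrow> g \<in> dual s U \<Longrightarrow> f + g \<in> dual s U"
  using dual_lincomb[of f s U g 1] by (simp add: plus_fun_def)

lemma dual_scale: "f \<in> dual s U \<Longrightarrow> (\<lambda>v. c * f v) \<in> dual s U"
  using dual_lincomb[OF _ zero_in_dual] by fastforce

lemmas bidual_lincomb = dual_lincomb[where s = "\<lambda>c f v. c * f v" and U = "dual s U" for s U, folded bidual_def]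
lemmas bidual_scale = dual_scale[where s = "\<lambda>c f v. c * f v" and U = "dual s U" for s U, folded bidual_def]
lemmas zero_in_bidual = zero_in_dual[where s = "\<lambda>c f v. c * f v" and U = "dual s U" for s U, folded bidual_def]

lemma bidual_outside: "v \<in> bidual s U \<Longrightarrow> f \<notin> dual s U \<Longrightarrow> v f = 0"
  by (simp add: bidual_def dual_def[of _ "dual s U"])

lemma bidual_comb: "v \<in> bidual s U \<Longrightarrow> f \<in> dual s U \<Longrightarrow> g \<in> dual s U \<Longrightarrow>
    v (\<lambda>u. c * f u + g u) = c * v f + v g"
proof -
  assume v: "v \<in> bidual s U" and f: "f \<in> dual s U" and g: "g \<in> dual s U"
  have "v ((\<lambda>u. c * f u) + g) = v (\<lambda>u. c * f u) + v g"
    using v dual_scale[OF f] g unfolding bidual_def dual_def[of _ "dual s U"] by blast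
  moreover have "v (\<lambda>u. c * f u) = c * v f"
    using v f unfolding bidual_def dual_def[of _ "dual s U"] by blast
  ultimately show ?thesis by (simp add: plus_fun_def)
qed

lemma bidualI:
  assumes "\<And>c f g. f \<in> dual s U \<Longrightarrow> g \<in> dual s U \<Longrightarrow> v (\<lambda>u. c * f u + g u) = c * v f + v g"
    and "\<And>f. f \<notin> dual s U \<Longrightarrow> v f = 0"
  shows "v \<in> bidual s U"
proof -
  have z: "v (\<lambda>u. 0) = 0"
    using assms(1)[OF zero_in_dual zero_in_dual, where c = 1] by simp
  have "v (\<lambda>u. c * f u) = c * v f" if "f \<in> dual s U" for c f
    using assms(1)[OF that zero_in_dual, of c] z by simp
  moreover have "v (f + g) = v f + v g" if "f \<in> dual s U" "g \<in> dual s U" for f g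
    using assms(1)[OF that, of 1] by (simp add: plus_fun_def)
  ultimately show ?thesis
    unfolding bidual_def dual_def[of _ "dual s U"] using assms(2) by blast
qed

lemma eval_in_bidual:
  shows "(\<lambda>f. if f \<in> dual s U then f e else 0) \<in> bidual s U"
  by (rule bidualI) (auto simp: dual_lincomb)

text \<open>
  Dual vectors are functions on the whole ambient space, extended by zero, and \<open>basis_of\<close> is a fixed
  but arbitrary choice. The locale provides the dual basis of that choice and the resulting
  coordinates in \<open>U\<close>, in its dual and in its bidual; the last ones are the components of tensors.
\<close>

locale fin_dim = vector_space s for s :: "complex \<Rightarrow> 'v::ab_group_add \<Rightarrow> 'v" +
  fixes U :: "'v set"
  assumes subspace: "subspace U" and spanned: "\<exists>B. finite B \<and> span B = U"
begin

abbreviation "B \<equiv> basis_of s U"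

definition coord :: "'v \<Rightarrow> 'v covec" where
  "coord e = (\<lambda>v. representation B v e)"

lemma basis: "independent B" "span B = U" "finite B"
proof -
  obtain A where A: "A \<subseteq> U" "independent A" "U \<subseteq> span A"
    using basis_exists by metis
  then have "independent A \<and> span A = U"
    using span_subspace subspace by blast
  then have "independent B \<and> span B = U"
    unfolding basis_of_def by (rule someI)
  then show 1: "independent B" "span B = U" by auto
  show "finite B"
    using spanned independent_span_bound[OF _ 1(1)] 1(2) span_superset by metis
qed

lemma basis_subset: "B \<subseteq> U"
  using basis span_superset by metis

lemma basis_zero: "U = {0} \<Longrightarrow> B = {}"
  using basis_subset basis(1) dependent_zero by blast

lemma coord_in_dual: "coord e \<in> dual s U"
proof -
  have "coord e u = 0" if "u \<notin> U" for u
    using that basis by (simp add: coord_def representation_def)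
  then show ?thesis
    using basis by (auto simp: dual_def coord_def representation_add representation_scale)
qed

lemma coord_basis: "e \<in> B \<Longrightarrow> e' \<in> B \<Longrightarrow> coord e e' = (if e = e' then 1 else 0)"
  using basis by (auto simp: coord_def representation_basis)

lemma dual_expand:
  assumes f: "f \<in> dual s U" 
  shows "f = (\<Sum>e\<in>B. (\<lambda>v. f e * coord e v))"
proof
  fix u
  show "f u = (\<Sum>e\<in>B. (\<lambda>v. f e * coord e v)) u"
  proof (cases "u \<in> U")
    case True
    have "f u = f (\<Sum>e\<in>B. s (coord e u) e)"
      using sum_representation_eq[of B u B] basis True by (simp add: coord_def)
    also have "\<dots> = (\<Sum>e\<in>B. coord e u * f e)"
      by (rule dual_sum[OF f])
        (use subspace basis_subset in \<open>auto simp: subspace_0 subspace_add subspace_scale\<close>)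
    finally show ?thesis by (simp add: sum_fun_apply mult.commute)
  next
    case False
    then have "coord e u = 0" for e using coord_in_dual by (simp add: dual_def)
    then show ?thesis using f False by (simp add: sum_fun_apply dual_def)
  qed
qed

lemma bidual_expand:
  assumes v: "v \<in> bidual s U" and f: "f \<in> dual s U"
  shows "v f = (\<Sum>e\<in>B. v (coord e) * f e)"
proof -
  have "v f = v (\<Sum>e\<in>B. (\<lambda>v. f e * coord e v))"
    using dual_expand[OF f] by simp
  also have "\<dots> = (\<Sum>e\<in>B. f e * v (coord e))"
    by (rule dual_sum[OF v[unfolded bidual_def]])
      (use zero_in_dual in \<open>auto simp: coord_in_dual dual_scale dual_add zero_fun_def\<close>)
  finally show ?thesis by (simp add: mult.commute)
qed

lemma bidual_zero: "U = {0} \<Longrightarrow> v \<in> bidual s U \<Longrightarrow> v f = 0"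
  using bidual_expand[of v f] bidual_outside[of v s U f] basis_zero by fastforce

end

lemma finite_type_fin_dim:
  "finite_type \<pi> V \<Longrightarrow> \<alpha> \<in> Arr \<pi> \<Longrightarrow> fin_dim (scal V) (fib V \<alpha>)"
  by (simp add: finite_type_def fin_dim_def fin_dim_axioms_def)

section \<open>Homogeneous tensors and degree-preserving maps\<close>

text \<open>
  Not only loops are needed: contracting the first factor of a tensor from \<open>a\<close> to \<open>b\<close> at an arrow
  \<open>a \<rightarrow> c\<close> leaves a vector supported on the arrows from \<open>c\<close> to \<open>b\<close>.
\<close>

definition hom_space ::
  "('o, 'p, 'a, 'm) arrows_scheme \<Rightarrow> ('a, 'u::ab_group_add) vfamily \<Rightarrow> 'o \<Rightarrow> 'p \<Rightarrow> ('a, 'u) ten1 set" where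
  "hom_space \<pi> U a b = {x.
     (\<forall>\<alpha>. if \<alpha> \<in> Arr \<pi> \<and> src \<pi> \<alpha> = a \<and> tgt \<pi> \<alpha> = b then x \<alpha> \<in> bidual (scal U) (fib U \<alpha>) else x \<alpha> = 0) \<and>
     finite {\<alpha>. x \<alpha> \<noteq> 0}}"

lemma loop_space_eq: "loop_space \<pi> U a = hom_space \<pi> U a a"
  by (simp add: loop_space_def hom_space_def loops_def)

definition string_space where
  "string_space \<pi> U \<rho> V a b =
     {x \<in> tensor2 \<pi> U \<rho> V. \<forall>\<alpha> \<beta>. x \<alpha> \<beta> \<noteq> 0 \<longrightarrow> src \<pi> \<alpha> = a \<and> tgt \<rho> \<beta> = b}"

text \<open>
  Since the zero form is multilinear, the case distinction in the definition can be split into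
  multilinearity everywhere and a condition on the support, which are inherited separately by the
  constructions below. The same holds for two factors.
\<close>

lemma hom_space_iff:
  "x \<in> hom_space \<pi> U a b \<longleftrightarrow>
     (\<forall>\<alpha>. x \<alpha> \<in> bidual (scal U) (fib U \<alpha>)) \<and>
     (\<forall>\<alpha> f. x \<alpha> f \<noteq> 0 \<longrightarrow> \<alpha> \<in> Arr \<pi> \<and> src \<pi> \<alpha> = a \<and> tgt \<pi> \<alpha> = b) \<and>
     finite {\<alpha>. x \<alpha> \<noteq> 0}"
proof -
  have "(if P then x \<alpha> \<in> bidual (scal U) (fib U \<alpha>) else x \<alpha> = 0) \<longleftrightarrow>
      x \<alpha> \<in> bidual (scal U) (fib U \<alpha>) \<and> (\<forall>f. x \<alpha> f \<noteq> 0 \<longrightarrow> P)" for \<alpha> P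
  proof (cases P)
    case False
    have "x \<alpha> = 0 \<longleftrightarrow> (\<forall>f. x \<alpha> f = 0)" by (auto simp: fun_eq_iff)
    then show ?thesis
      using False zero_in_bidual[of "scal U" "fib U \<alpha>"] by (auto simp: zero_fun_def)
  qed simp
  then show ?thesis unfolding hom_space_def by (auto; metis)
qed

lemma hom_space_support:
  "x \<in> hom_space \<pi> U a b \<Longrightarrow> x \<alpha> f \<noteq> 0 \<Longrightarrow> \<alpha> \<in> Arr \<pi> \<and> src \<pi> \<alpha> = a \<and> tgt \<pi> \<alpha> = b"
  unfolding hom_space_iff by blast

lemma tensor2_iff:
  "x \<in> tensor2 \<pi> U \<rho> V \<longleftrightarrow>
     (\<forall>\<alpha> \<beta> g. (\<lambda>f. x \<alpha> \<beta> f g) \<in> bidual (scal U) (fib U \<alpha>)) \<and>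
     (\<forall>\<alpha> \<beta> f. x \<alpha> \<beta> f \<in> bidual (scal V) (fib V \<beta>)) \<and>
     (\<forall>\<alpha> \<beta> f g. x \<alpha> \<beta> f g \<noteq> 0 \<longrightarrow> \<alpha> \<in> Arr \<pi> \<and> \<beta> \<in> Arr \<rho> \<and> tgt \<pi> \<alpha> = src \<rho> \<beta>) \<and>
     finite {(\<alpha>, \<beta>). x \<alpha> \<beta> \<noteq> 0}"
proof -
  have "(if P then (\<forall>g. (\<lambda>f. x \<alpha> \<beta> f g) \<in> bidual (scal U) (fib U \<alpha>)) \<and>
             (\<forall>f. (\<lambda>g. x \<alpha> \<beta> f g) \<in> bidual (scal V) (fib V \<beta>)) else x \<alpha> \<beta> = 0) \<longleftrightarrow>
      (\<forall>g. (\<lambda>f. x \<alpha> \<beta> f g) \<in> bidual (scal U) (fib U \<alpha>)) \<and>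
             (\<forall>f. x \<alpha> \<beta> f \<in> bidual (scal V) (fib V \<beta>)) \<and> (\<forall>f g. x \<alpha> \<beta> f g \<noteq> 0 \<longrightarrow> P)" for \<alpha> \<beta> P
  proof (cases P)
    case False
    have "x \<alpha> \<beta> = 0 \<longleftrightarrow> (\<forall>f g. x \<alpha> \<beta> f g = 0)" by (auto simp: fun_eq_iff)
    then show ?thesis
      using False zero_in_bidual[of "scal U" "fib U \<alpha>"] zero_in_bidual[of "scal V" "fib V \<beta>"]
      by (auto simp: zero_fun_def)
  qed simp
  then show ?thesis unfolding tensor2_def mem_Collect_eq by meson
qed

lemma string_space_iff:
  "x \<in> string_space \<pi> U \<rho> V a b \<longleftrightarrow> x \<in> tensor2 \<pi> U \<rho> V \<and>
     (\<forall>\<alpha> \<beta> f g. x \<alpha> \<beta> f g \<noteq> 0 \<longrightarrow> src \<pi> \<alpha> = a \<and> tgt \<rho> \<beta> = b)"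
  by (auto simp: string_space_def fun_eq_iff)

lemma string_space_support:
  "x \<in> string_space \<pi> U \<rho> V a b \<Longrightarrow> x \<alpha> \<beta> f g \<noteq> 0 \<Longrightarrow>
     \<alpha> \<in> Arr \<pi> \<and> \<beta> \<in> Arr \<rho> \<and> tgt \<pi> \<alpha> = src \<rho> \<beta> \<and> src \<pi> \<alpha> = a \<and> tgt \<rho> \<beta> = b"
  unfolding string_space_iff tensor2_iff by blast

lemma string_space_bidual:
  assumes "x \<in> string_space \<pi> U \<rho> V a b"
  shows "(\<lambda>f. x \<alpha> \<beta> f g) \<in> bidual (scal U) (fib U \<alpha>)" and "x \<alpha> \<beta> f \<in> bidual (scal V) (fib V \<beta>)"
  using assms unfolding string_space_iff tensor2_iff by blast+

lemma string_space_tensor2: "x \<in> string_space \<pi> U \<rho> V a b \<Longrightarrow> x \<in> tensor2 \<pi> U \<rho> V"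
  by (simp add: string_space_def)

definition otimes :: "('a, 'u) ten1 \<Rightarrow> ('b, 'v) ten1 \<Rightarrow> ('a, 'u, 'b, 'v) ten2" where
  "otimes x y = (\<lambda>\<alpha> \<beta> f g. x \<alpha> f * y \<beta> g)"

text \<open>
  The vector \<open>e\<close> of the component at \<open>\<beta>\<close>, as an element of the bidual.
\<close>

definition embed :: "('b, 'w::ab_group_add) vfamily \<Rightarrow> 'b \<Rightarrow> 'w \<Rightarrow> ('b, 'w) ten1" where
  "embed W \<beta> e = (\<lambda>\<beta>' g. if \<beta>' = \<beta> \<and> g \<in> dual (scal W) (fib W \<beta>) then g e else 0)"

definition contract :: "('a, 'u, 'b, 'v) ten2 \<Rightarrow> 'a \<Rightarrow> 'u covec \<Rightarrow> ('b, 'v) ten1" where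
  "contract t \<alpha> f = (\<lambda>\<beta> g. t \<alpha> \<beta> f g)"

lemma tensor_vec_otimes: "tensor_vec x W \<beta> e = otimes x (embed W \<beta> e)"
  by (auto simp: tensor_vec_def otimes_def embed_def fun_eq_iff)

lemma embed_in_hom_space:
  assumes "\<beta> \<in> Arr \<rho>" shows "embed W \<beta> e \<in> hom_space \<rho> W (src \<rho> \<beta>) (tgt \<rho> \<beta>)"
proof -
  have "embed W \<beta> e \<beta>' \<in> bidual (scal W) (fib W \<beta>')" for \<beta>'
    using eval_in_bidual[of "scal W" "fib W \<beta>" e] zero_in_bidual
    by (cases "\<beta>' = \<beta>") (auto simp: embed_def)
  moreover have "{\<beta>'. embed W \<beta> e \<beta>' \<noteq> 0} \<subseteq> {\<beta>}"
    by (auto simp: embed_def)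
  ultimately show ?thesis
    using assms unfolding hom_space_iff by (auto simp: embed_def finite_subset split: if_splits)
qed

lemma otimes_in_string_space:
  assumes x: "x \<in> hom_space \<pi> U a c" and y: "y \<in> hom_space \<rho> V c b"
  shows "otimes x y \<in> string_space \<pi> U \<rho> V a b"
proof -
  have "otimes x y \<alpha> \<beta> = 0" if "x \<alpha> = 0 \<or> y \<beta> = 0" for \<alpha> \<beta>
    using that by (auto simp: otimes_def fun_eq_iff)
  then have "{(\<alpha>, \<beta>). otimes x y \<alpha> \<beta> \<noteq> 0} \<subseteq> {\<alpha>. x \<alpha> \<noteq> 0} \<times> {\<beta>. y \<beta> \<noteq> 0}"
    by blast
  moreover have "finite \<dots>" using x y by (auto simp: hom_space_iff)
  ultimately have "finite {(\<alpha>, \<beta>). otimes x y \<alpha> \<beta> \<noteq> 0}" by (rule finite_subset)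
  moreover have "(\<lambda>f. otimes x y \<alpha> \<beta> f g) \<in> bidual (scal U) (fib U \<alpha>)" for \<alpha> \<beta> g
    using bidual_scale[of "x \<alpha>" "scal U" "fib U \<alpha>" "y \<beta> g"] x
    by (simp add: otimes_def mult.commute hom_space_iff)
  moreover have "otimes x y \<alpha> \<beta> f \<in> bidual (scal V) (fib V \<beta>)" for \<alpha> \<beta> f
    using bidual_scale[of "y \<beta>" "scal V" "fib V \<beta>" "x \<alpha> f"] y
    by (simp add: otimes_def hom_space_iff)
  moreover have "\<alpha> \<in> Arr \<pi> \<and> \<beta> \<in> Arr \<rho> \<and> tgt \<pi> \<alpha> = src \<rho> \<beta> \<and> src \<pi> \<alpha> = a \<and> tgt \<rho> \<beta> = b"
    if "otimes x y \<alpha> \<beta> f g \<noteq> 0" for \<alpha> \<beta> f g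
  proof -
    have "x \<alpha> f \<noteq> 0" "y \<beta> g \<noteq> 0" using that by (auto simp: otimes_def)
    then show ?thesis using hom_space_support[OF x] hom_space_support[OF y] by simp
  qed
  ultimately show ?thesis
    unfolding string_space_iff tensor2_iff by simp
qed

lemma contract_in_hom_space:
  assumes t: "t \<in> string_space \<pi> U \<rho> V a b"
  shows "contract t \<alpha> f \<in> hom_space \<rho> V (tgt \<pi> \<alpha>) b"
proof -
  have "{\<beta>. contract t \<alpha> f \<beta> \<noteq> 0} \<subseteq> snd ` {(\<alpha>, \<beta>). t \<alpha> \<beta> \<noteq> 0}"
    by (force simp: contract_def fun_eq_iff)
  moreover have "finite \<dots>" using t by (auto simp: string_space_iff tensor2_iff)
  ultimately have "finite {\<beta>. contract t \<alpha> f \<beta> \<noteq> 0}" by (rule finite_subset)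
  then show ?thesis using t
    by (simp add: hom_space_iff string_space_iff tensor2_iff contract_def) metis
qed

lemma tensor2_zero: "(\<lambda>\<alpha> \<beta> f g. 0) \<in> tensor2 \<pi> U \<rho> V"
  by (simp add: tensor2_iff zero_in_bidual zero_fun_def)

lemma tensor2_lincomb:
  assumes "x \<in> tensor2 \<pi> U \<rho> V" "y \<in> tensor2 \<pi> U \<rho> V"
  shows "(\<lambda>\<alpha> \<beta> f g. c * x \<alpha> \<beta> f g + y \<alpha> \<beta> f g) \<in> tensor2 \<pi> U \<rho> V"
proof -
  have "{(\<alpha>, \<beta>). (\<lambda>f g. c * x \<alpha> \<beta> f g + y \<alpha> \<beta> f g) \<noteq> 0}
      \<subseteq> {(\<alpha>, \<beta>). x \<alpha> \<beta> \<noteq> 0} \<union> {(\<alpha>, \<beta>). y \<alpha> \<beta> \<noteq> 0}" by (auto simp: zero_fun_def)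
  moreover have "finite \<dots>" using assms by (auto simp: tensor2_iff)
  ultimately have "finite {(\<alpha>, \<beta>). (\<lambda>f g. c * x \<alpha> \<beta> f g + y \<alpha> \<beta> f g) \<noteq> 0}" by (rule finite_subset)
  moreover have "\<alpha> \<in> Arr \<pi> \<and> \<beta> \<in> Arr \<rho> \<and> tgt \<pi> \<alpha> = src \<rho> \<beta>"
    if "c * x \<alpha> \<beta> f g + y \<alpha> \<beta> f g \<noteq> 0" for \<alpha> \<beta> f g
  proof -
    have "x \<alpha> \<beta> f g \<noteq> 0 \<or> y \<alpha> \<beta> f g \<noteq> 0" using that by auto
    then show ?thesis using assms unfolding tensor2_iff by metis
  qed
  moreover have "(\<lambda>f. c * x \<alpha> \<beta> f g + y \<alpha> \<beta> f g) \<in> bidual (scal U) (fib U \<alpha>)" for \<alpha> \<beta> g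
    by (rule bidual_lincomb) (use assms in \<open>simp_all add: tensor2_iff\<close>)
  moreover have "(\<lambda>g. c * x \<alpha> \<beta> f g + y \<alpha> \<beta> f g) \<in> bidual (scal V) (fib V \<beta>)" for \<alpha> \<beta> f
    by (rule bidual_lincomb) (use assms in \<open>simp_all add: tensor2_iff\<close>)
  ultimately show ?thesis
    unfolding tensor2_iff by simp
qed

lemma tensor2_sum:
  assumes "\<And>i. i \<in> I \<Longrightarrow> x i \<in> tensor2 \<pi> U \<rho> V"
  shows "(\<lambda>\<alpha> \<beta> f g. \<Sum>i\<in>I. c i * x i \<alpha> \<beta> f g) \<in> tensor2 \<pi> U \<rho> V"
  using assms by (induction I rule: infinite_finite_induct) (auto intro: tensor2_zero tensor2_lincomb)

lemma graded_maps_mem: "F \<in> graded_maps X dX Y dY \<Longrightarrow> x \<in> X \<Longrightarrow> F x \<in> Y"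
  by (simp add: graded_maps_def)

lemma graded_maps_homogeneous:
  "F \<in> graded_maps X dX Y dY \<Longrightarrow> x \<in> X \<Longrightarrow> \<forall>\<alpha> \<beta>. x \<alpha> \<beta> \<noteq> 0 \<longrightarrow> dX \<alpha> \<beta> = d \<Longrightarrow> F x \<alpha> \<beta> \<noteq> 0 \<Longrightarrow> dY \<alpha> \<beta> = d"
  by (simp add: graded_maps_def)

lemma graded_maps_sum:
  assumes F: "F \<in> graded_maps (tensor2 \<pi> U \<rho> V) dX Y dY"
    and x: "\<And>i. i \<in> I \<Longrightarrow> x i \<in> tensor2 \<pi> U \<rho> V"
  shows "F (\<lambda>\<alpha> \<beta> f g. \<Sum>i\<in>I. c i * x i \<alpha> \<beta> f g) = (\<lambda>\<alpha> \<beta> f g. \<Sum>i\<in>I. c i * F (x i) \<alpha> \<beta> f g)"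
proof -
  have lin: "F (\<lambda>\<alpha> \<beta> f g. c * x \<alpha> \<beta> f g + y \<alpha> \<beta> f g) = (\<lambda>\<alpha> \<beta> f g. c * F x \<alpha> \<beta> f g + F y \<alpha> \<beta> f g)"
    if "x \<in> tensor2 \<pi> U \<rho> V" "y \<in> tensor2 \<pi> U \<rho> V" for c x y
    using F that by (simp add: graded_maps_def)
  have z: "F (\<lambda>\<alpha> \<beta> f g. 0) = (\<lambda>\<alpha> \<beta> f g. 0)"
    using lin[OF tensor2_zero tensor2_zero, of 1] by (simp add: fun_eq_iff)
  show ?thesis
    using x
    by (induction I rule: infinite_finite_induct) (simp_all add: z lin tensor2_sum)
qed

lemma graded_maps_scale:
  assumes F: "F \<in> graded_maps (tensor2 \<pi> U \<rho> V) dX Y dY"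
    and x: "x \<in> tensor2 \<pi> U \<rho> V"
  shows "F (\<lambda>\<alpha> \<beta> f g. c * x \<alpha> \<beta> f g) = (\<lambda>\<alpha> \<beta> f g. c * F x \<alpha> \<beta> f g)"
  using graded_maps_sum[OF F, of "{()}" "\<lambda>_. x" "\<lambda>_. c"] x by simp

text \<open>
  The definition of a graded map speaks of homogeneous elements only. A general element is a finite
  sum of its components at single strings, so that by linearity every degree in the image already
  occurs in the argument.
\<close>

lemma graded_maps_degree:
  assumes F: "F \<in> graded_maps (tensor2 \<pi> U \<rho> V) dX Y dY"
    and x: "x \<in> tensor2 \<pi> U \<rho> V" and nz: "F x \<alpha> \<beta> \<noteq> 0"
  shows "\<exists>\<alpha>' \<beta>'. x \<alpha>' \<beta>' \<noteq> 0 \<and> dX \<alpha>' \<beta>' = dY \<alpha> \<beta>"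
proof -
  define S where "S = {(\<alpha>, \<beta>). x \<alpha> \<beta> \<noteq> 0}"
  define r where "r = (\<lambda>i \<alpha> \<beta>. if (\<alpha>, \<beta>) = i then x \<alpha> \<beta> else 0)"
  have fS: "finite S" using x by (simp add: S_def tensor2_def)
  have r: "r i \<in> tensor2 \<pi> U \<rho> V" for i
  proof -
    have "{(\<alpha>, \<beta>). r i \<alpha> \<beta> \<noteq> 0} \<subseteq> {i}" by (auto simp: r_def split: if_splits)
    then have "finite {(\<alpha>, \<beta>). r i \<alpha> \<beta> \<noteq> 0}" by (rule finite_subset) simp
    then show ?thesis using x unfolding tensor2_def
      by (auto simp: r_def zero_fun_def zero_in_bidual)
  qed
  have "x = (\<lambda>\<alpha> \<beta> f g. \<Sum>i\<in>S. 1 * r i \<alpha> \<beta> f g)"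
  proof (intro ext)
    fix \<alpha> \<beta> f g
    have "(\<Sum>i\<in>S. 1 * r i \<alpha> \<beta> f g) = (\<Sum>i\<in>S. if i = (\<alpha>, \<beta>) then x \<alpha> \<beta> f g else 0)"
      by (rule sum.cong) (auto simp: r_def)
    also have "\<dots> = x \<alpha> \<beta> f g" using fS by (auto simp: sum.delta S_def)
    finally show "x \<alpha> \<beta> f g = (\<Sum>i\<in>S. 1 * r i \<alpha> \<beta> f g)" by simp
  qed
  then have "F x = (\<lambda>\<alpha> \<beta> f g. \<Sum>i\<in>S. 1 * F (r i) \<alpha> \<beta> f g)"
    using graded_maps_sum[OF F, of S r "\<lambda>_. 1"] r by simp
  then have "\<exists>i\<in>S. F (r i) \<alpha> \<beta> \<noteq> 0"
    using nz by (auto simp: fun_eq_iff) (metis (no_types, lifting) sum.neutral)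
  then obtain \<alpha>' \<beta>' where i: "(\<alpha>', \<beta>') \<in> S" "F (r (\<alpha>', \<beta>')) \<alpha> \<beta> \<noteq> 0" by auto
  have "\<forall>\<alpha> \<beta>. r (\<alpha>', \<beta>') \<alpha> \<beta> \<noteq> 0 \<longrightarrow> dX \<alpha> \<beta> = dX \<alpha>' \<beta>'" by (simp add: r_def)
  then have "dY \<alpha> \<beta> = dX \<alpha>' \<beta>'"
    using graded_maps_homogeneous[OF F, OF r, of "(\<alpha>', \<beta>')" "dX \<alpha>' \<beta>'" \<alpha> \<beta>] i(2) by simp
  then show ?thesis using i(1) by (auto simp: S_def)
qed

text \<open>
  The composite of a string determines its source and target, but a tensor from \<open>a\<close> to \<open>b\<close> has
  strings of many composites; this is why the preceding lemma is called for. From here on the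
  operators \<open>R1\<close>, \<open>R2\<close>, \<open>C\<close> and the inverse of \<open>C\<close> are treated alike.
\<close>

lemma End2_subset_Hom2:
  assumes "is_groupoid \<pi>"
  shows "End2 \<pi> V \<subseteq> Hom2 \<pi> V \<pi> V \<pi> V \<pi> V"
proof
  fix F assume F: "F \<in> End2 \<pi> V"
  have comp: "src \<pi> (comp \<pi> \<beta> \<alpha>) = src \<pi> \<alpha> \<and> tgt \<pi> (comp \<pi> \<beta> \<alpha>) = tgt \<pi> \<beta>"
    if "x \<in> tensor2 \<pi> V \<pi> V" "x \<alpha> \<beta> \<noteq> 0" for x \<alpha> \<beta>
    using that assms unfolding tensor2_def is_groupoid_def by (auto split: if_splits) metis+
  have "(src \<pi> \<alpha>, tgt \<pi> \<beta>) = d"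
    if x: "x \<in> tensor2 \<pi> V \<pi> V" and d: "\<forall>\<alpha> \<beta>. x \<alpha> \<beta> \<noteq> 0 \<longrightarrow> (src \<pi> \<alpha>, tgt \<pi> \<beta>) = d" and nz: "F x \<alpha> \<beta> \<noteq> 0"
    for x d \<alpha> \<beta>
  proof -
    have "\<exists>\<alpha>' \<beta>'. x \<alpha>' \<beta>' \<noteq> 0 \<and> comp \<pi> \<beta>' \<alpha>' = comp \<pi> \<beta> \<alpha>"
      by (rule graded_maps_degree[OF F[unfolded End2_def], OF x, OF nz])
    then obtain \<alpha>' \<beta>' where "x \<alpha>' \<beta>' \<noteq> 0" "comp \<pi> \<beta>' \<alpha>' = comp \<pi> \<beta> \<alpha>"
      by (elim exE conjE)
    moreover have "F x \<in> tensor2 \<pi> V \<pi> V"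
      using graded_maps_mem[OF F[unfolded End2_def], OF x] .
    ultimately show ?thesis using comp x nz d by metis
  qed
  then show "F \<in> Hom2 \<pi> V \<pi> V \<pi> V \<pi> V"
    using F unfolding Hom2_def End2_def graded_maps_def mem_Collect_eq by meson
qed

lemma Hom2_string_space:
  assumes F: "F \<in> Hom2 \<pi> U \<rho> V \<pi>' U' \<rho>' V'" and x: "x \<in> string_space \<pi> U \<rho> V a b"
  shows "F x \<in> string_space \<pi>' U' \<rho>' V' a b"
proof -
  have "\<forall>\<alpha> \<beta>. x \<alpha> \<beta> \<noteq> 0 \<longrightarrow> (src \<pi> \<alpha>, tgt \<rho> \<beta>) = (a, b)" "x \<in> tensor2 \<pi> U \<rho> V"
    using x by (auto simp: string_space_def)
  then have "\<forall>\<alpha> \<beta>. F x \<alpha> \<beta> \<noteq> 0 \<longrightarrow> (src \<pi>' \<alpha>, tgt \<rho>' \<beta>) = (a, b)" "F x \<in> tensor2 \<pi>' U' \<rho>' V'"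
    using graded_maps_homogeneous[OF F[unfolded Hom2_def], of x "(a, b)"]
      graded_maps_mem[OF F[unfolded Hom2_def], of x] by blast+
  then show ?thesis by (simp add: string_space_def)
qed

lemma Hom2_sum:
  assumes "F \<in> Hom2 \<pi> U \<rho> V \<pi>' U' \<rho>' V'" and "\<And>i. i \<in> I \<Longrightarrow> x i \<in> tensor2 \<pi> U \<rho> V"
  shows "F (\<lambda>\<alpha> \<beta> f g. \<Sum>i\<in>I. c i * x i \<alpha> \<beta> f g) = (\<lambda>\<alpha> \<beta> f g. \<Sum>i\<in>I. c i * F (x i) \<alpha> \<beta> f g)"
  by (rule graded_maps_sum[OF assms(1)[unfolded Hom2_def]]) (rule assms(2))

section \<open>Bases of the spaces of homogeneous tensors\<close>

definition dual_vec :: "('b, 'w::ab_group_add) vfamily \<Rightarrow> 'b \<Rightarrow> 'w \<Rightarrow> 'w covec" where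
  "dual_vec W \<beta> e = (\<lambda>v. module.representation (scal W) (basis_of (scal W) (fib W \<beta>)) v e)"

abbreviation basis_at :: "('b, 'w::ab_group_add) vfamily \<Rightarrow> 'b \<Rightarrow> 'w set" where
  "basis_at W \<beta> \<equiv> basis_of (scal W) (fib W \<beta>)"

definition strings where
  "strings \<pi> U \<rho> V a b = {(\<alpha>, \<beta>). \<alpha> \<in> Arr \<pi> \<and> \<beta> \<in> Arr \<rho> \<and> src \<pi> \<alpha> = a \<and> tgt \<pi> \<alpha> = src \<rho> \<beta> \<and>
     tgt \<rho> \<beta> = b \<and> fib U \<alpha> \<noteq> {0} \<and> fib V \<beta> \<noteq> {0}}"

text \<open>
  The indices of the basis of \<open>(U \<otimes> V)\<^sub>a\<^sub>b\<close> formed by the tensor products of basis vectors: a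
  string together with a pair of basis vectors. Keeping the string apart from the vectors turns
  sums over the basis into iterated sums.
\<close>

definition basis_strings where
  "basis_strings \<pi> U \<rho> V a b = Sigma (strings \<pi> U \<rho> V a b) (\<lambda>(\<alpha>, \<beta>). basis_at U \<alpha> \<times> basis_at V \<beta>)"

fun lvec :: "('a, 'u::ab_group_add) vfamily \<Rightarrow> ('a \<times> 'b) \<times> ('u \<times> 'v) \<Rightarrow> ('a, 'u) ten1" where
  "lvec U ((\<alpha>, \<beta>), (e, e')) = embed U \<alpha> e"

fun rvec :: "('b, 'v::ab_group_add) vfamily \<Rightarrow> ('a \<times> 'b) \<times> ('u \<times> 'v) \<Rightarrow> ('b, 'v) ten1" where
  "rvec V ((\<alpha>, \<beta>), (e, e')) = embed V \<beta> e'"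

definition basis_tensor where
  "basis_tensor U V i = otimes (lvec U i) (rvec V i)"

fun coeff2 :: "_ \<Rightarrow> _ \<Rightarrow> ('a, 'u::ab_group_add, 'b, 'v::ab_group_add) ten2 \<Rightarrow> _ \<Rightarrow> complex" where
  "coeff2 U V t ((\<alpha>, \<beta>), (e, e')) = t \<alpha> \<beta> (dual_vec U \<alpha> e) (dual_vec V \<beta> e')"

lemma basis_stringsE:
  assumes "i \<in> basis_strings \<pi> U \<rho> V a b"
  obtains \<alpha> \<beta> e e' where "i = ((\<alpha>, \<beta>), (e, e'))" "\<alpha> \<in> Arr \<pi>" "\<beta> \<in> Arr \<rho>" "e \<in> basis_at U \<alpha>" "e' \<in> basis_at V \<beta>"
    "src \<pi> \<alpha> = a" "tgt \<pi> \<alpha> = src \<rho> \<beta>" "tgt \<rho> \<beta> = b"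
proof -
  obtain \<alpha> \<beta> e e' where i: "i = ((\<alpha>, \<beta>), (e, e'))" by (metis surj_pair)
  show ?thesis
    by (rule that[OF i]) (use assms in \<open>simp_all add: i basis_strings_def strings_def\<close>)
qed

lemma finite_strings:
  assumes U: "finite_type \<pi> U" and V: "finite_type \<rho> V"
  shows "finite {(\<alpha>, \<beta>). \<alpha> \<in> Arr \<pi> \<and> \<beta> \<in> Arr \<rho> \<and> src \<pi> \<alpha> = a \<and> tgt \<pi> \<alpha> = src \<rho> \<beta> \<and>
     fib U \<alpha> \<noteq> {0} \<and> fib V \<beta> \<noteq> {0}}" (is "finite ?S")
proof -
  have "?S \<subseteq> Sigma {\<alpha> \<in> Arr \<pi>. src \<pi> \<alpha> = a \<and> fib U \<alpha> \<noteq> {0}}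
     (\<lambda>\<alpha>. {\<beta> \<in> Arr \<rho>. src \<rho> \<beta> = tgt \<pi> \<alpha> \<and> fib V \<beta> \<noteq> {0}})" by auto
  moreover have "finite \<dots>"
    using U V by (intro finite_SigmaI) (simp_all add: finite_type_def)
  ultimately show ?thesis by (rule finite_subset)
qed

lemma finite_basis_strings:
  assumes U: "finite_type \<pi> U" and V: "finite_type \<rho> V"
  shows "finite (strings \<pi> U \<rho> V a b)" "finite (basis_strings \<pi> U \<rho> V a b)"
proof -
  show f: "finite (strings \<pi> U \<rho> V a b)"
    by (rule finite_subset[OF _ finite_strings[OF U V, of a]]) (auto simp: strings_def)
  have "finite (basis_at U \<alpha> \<times> basis_at V \<beta>)" if "\<alpha> \<in> Arr \<pi>" "\<beta> \<in> Arr \<rho>" for \<alpha> \<beta>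
    using fin_dim.basis(3)[OF finite_type_fin_dim[OF U that(1)]]
      fin_dim.basis(3)[OF finite_type_fin_dim[OF V that(2)]] by simp
  then show "finite (basis_strings \<pi> U \<rho> V a b)"
    unfolding basis_strings_def using f by (intro finite_SigmaI) (auto simp: strings_def)
qed

lemma dual_vec_in_dual:
  assumes "finite_type \<pi> U" "\<alpha> \<in> Arr \<pi>"
  shows "dual_vec U \<alpha> e \<in> dual (scal U) (fib U \<alpha>)"
proof -
  interpret fin_dim "scal U" "fib U \<alpha>" by (rule finite_type_fin_dim) fact+
  show ?thesis using coord_in_dual[of e] by (simp add: dual_vec_def coord_def)
qed

lemma dual_vec_basis:
  assumes "finite_type \<pi> U" "\<alpha> \<in> Arr \<pi>" "e \<in> basis_at U \<alpha>" "e' \<in> basis_at U \<alpha>"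
  shows "dual_vec U \<alpha> e e' = (if e = e' then 1 else 0)"
proof -
  interpret fin_dim "scal U" "fib U \<alpha>" by (rule finite_type_fin_dim) fact+
  show ?thesis using coord_basis assms by (simp add: dual_vec_def coord_def)
qed

lemma bidual_embed_expand:
  assumes "finite_type \<pi> U" "\<alpha> \<in> Arr \<pi>" and v: "v \<in> bidual (scal U) (fib U \<alpha>)"
  shows "v f = (\<Sum>e\<in>basis_at U \<alpha>. v (dual_vec U \<alpha> e) * embed U \<alpha> e \<alpha> f)"
proof -
  interpret fin_dim "scal U" "fib U \<alpha>" by (rule finite_type_fin_dim) fact+
  have c: "dual_vec U \<alpha> = coord" by (simp add: dual_vec_def coord_def fun_eq_iff)
  show ?thesis
    using bidual_expand[OF v, of f] bidual_outside[OF v, of f]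
    by (cases "f \<in> dual (scal U) (fib U \<alpha>)") (simp_all add: c embed_def)
qed

lemma bidual_zero_fib:
  assumes "finite_type \<pi> U" "\<alpha> \<in> Arr \<pi>" and v: "v \<in> bidual (scal U) (fib U \<alpha>)" and "fib U \<alpha> = {0}"
  shows "v f = 0"
  by (rule fin_dim.bidual_zero[OF finite_type_fin_dim[OF assms(1,2)] assms(4,3)])

lemma string_space_strings:
  assumes U: "finite_type \<pi> U" and V: "finite_type \<rho> V"
    and t: "t \<in> string_space \<pi> U \<rho> V a b" and nz: "t \<alpha> \<beta> f g \<noteq> 0"
  shows "(\<alpha>, \<beta>) \<in> strings \<pi> U \<rho> V a b"
proof -
  have *: "\<alpha> \<in> Arr \<pi>" "\<beta> \<in> Arr \<rho>" "tgt \<pi> \<alpha> = src \<rho> \<beta>" "src \<pi> \<alpha> = a" "tgt \<rho> \<beta> = b"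
    using string_space_support[OF t, OF nz] by auto
  have 1: "(\<lambda>f. t \<alpha> \<beta> f g) \<in> bidual (scal U) (fib U \<alpha>)" and 2: "t \<alpha> \<beta> f \<in> bidual (scal V) (fib V \<beta>)"
    using string_space_bidual[OF t] by blast+
  have "fib U \<alpha> \<noteq> {0}" using bidual_zero_fib[OF U *(1) 1, of f] nz by argo
  moreover have "fib V \<beta> \<noteq> {0}" using bidual_zero_fib[OF V *(2) 2, of g] nz by argo
  ultimately show ?thesis using * by (simp add: strings_def)
qed

text \<open>
  By finite type only finitely many strings with given end points carry nonzero spaces, so the
  finiteness condition on the support comes for free for tensors with fixed end points. It is used
  for tensors given by a family of contractions, one for each of infinitely many covectors.
\<close>

lemma string_spaceI:
  assumes U: "finite_type \<pi> U" and V: "finite_type \<rho> V"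
    and "\<And>\<alpha> \<beta> g. (\<lambda>f. t \<alpha> \<beta> f g) \<in> bidual (scal U) (fib U \<alpha>)"
    and "\<And>\<alpha> \<beta> f. t \<alpha> \<beta> f \<in> bidual (scal V) (fib V \<beta>)"
    and "\<And>\<alpha> \<beta> f g. t \<alpha> \<beta> f g \<noteq> 0 \<Longrightarrow> \<alpha> \<in> Arr \<pi> \<and> \<beta> \<in> Arr \<rho> \<and> tgt \<pi> \<alpha> = src \<rho> \<beta> \<and> src \<pi> \<alpha> = a \<and> tgt \<rho> \<beta> = b"
  shows "t \<in> string_space \<pi> U \<rho> V a b"
proof -
  have "(\<alpha>, \<beta>) \<in> strings \<pi> U \<rho> V a b" if nz: "t \<alpha> \<beta> f g \<noteq> 0" for \<alpha> \<beta> f g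
  proof -
    have *: "\<alpha> \<in> Arr \<pi>" "\<beta> \<in> Arr \<rho>" using assms(5)[OF nz] by auto
    have "fib U \<alpha> \<noteq> {0}" using bidual_zero_fib[OF U *(1) assms(3)[of \<alpha> \<beta> g], of f] nz by argo
    moreover have "fib V \<beta> \<noteq> {0}" using bidual_zero_fib[OF V *(2) assms(4)[of \<alpha> \<beta> f], of g] nz by argo
    ultimately show ?thesis using assms(5)[OF nz] by (simp add: strings_def)
  qed
  then have "{(\<alpha>, \<beta>). t \<alpha> \<beta> \<noteq> 0} \<subseteq> strings \<pi> U \<rho> V a b"
    by (auto simp: fun_eq_iff)
  then have "finite {(\<alpha>, \<beta>). t \<alpha> \<beta> \<noteq> 0}"
    by (rule finite_subset) (rule finite_basis_strings[OF U V])
  then show ?thesis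
    using assms(3-5) by (simp add: string_space_iff tensor2_iff)
qed

lemma basis_vecs:
  assumes "i \<in> basis_strings \<pi> U \<rho> V a b"
  obtains c where "lvec U i \<in> hom_space \<pi> U a c" "rvec V i \<in> hom_space \<rho> V c b"
proof -
  obtain \<alpha> \<beta> e e' where i: "i = ((\<alpha>, \<beta>), (e, e'))" "\<alpha> \<in> Arr \<pi>" "\<beta> \<in> Arr \<rho>" "e \<in> basis_at U \<alpha>" "e' \<in> basis_at V \<beta>"
    "src \<pi> \<alpha> = a" "tgt \<pi> \<alpha> = src \<rho> \<beta>" "tgt \<rho> \<beta> = b"
    using assms by (rule basis_stringsE)
  show ?thesis
    by (rule that[of "tgt \<pi> \<alpha>"])
      (use i embed_in_hom_space[of \<alpha> \<pi> U e] embed_in_hom_space[of \<beta> \<rho> V e'] in simp_all)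
qed

lemma basis_tensor_in_string_space:
  assumes "i \<in> basis_strings \<pi> U \<rho> V a b"
  shows "basis_tensor U V i \<in> string_space \<pi> U \<rho> V a b"
proof -
  obtain c where "lvec U i \<in> hom_space \<pi> U a c" "rvec V i \<in> hom_space \<rho> V c b"
    using assms by (rule basis_vecs)
  then show ?thesis unfolding basis_tensor_def by (rule otimes_in_string_space)
qed

lemma basis_tensor_coeff:
  assumes U: "finite_type \<pi> U" and V: "finite_type \<rho> V"
    and i: "i \<in> basis_strings \<pi> U \<rho> V a b" and j: "j \<in> basis_strings \<pi> U \<rho> V a b"
  shows "coeff2 U V (basis_tensor U V i) j = (if i = j then 1 else 0)"
proof -
  obtain \<alpha> \<beta> e d where i': "i = ((\<alpha>, \<beta>), (e, d))" "\<alpha> \<in> Arr \<pi>" "\<beta> \<in> Arr \<rho>" "e \<in> basis_at U \<alpha>" "d \<in> basis_at V \<beta>"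
      "src \<pi> \<alpha> = a" "tgt \<pi> \<alpha> = src \<rho> \<beta>" "tgt \<rho> \<beta> = b"
    using i by (rule basis_stringsE)
  obtain \<alpha>' \<beta>' e' d' where j': "j = ((\<alpha>', \<beta>'), (e', d'))" "\<alpha>' \<in> Arr \<pi>" "\<beta>' \<in> Arr \<rho>" "e' \<in> basis_at U \<alpha>'" "d' \<in> basis_at V \<beta>'"
      "src \<pi> \<alpha>' = a" "tgt \<pi> \<alpha>' = src \<rho> \<beta>'" "tgt \<rho> \<beta>' = b"
    using j by (rule basis_stringsE)
  have "embed U \<alpha> e \<alpha>' (dual_vec U \<alpha>' e') = (if (\<alpha>, e) = (\<alpha>', e') then 1 else 0)"
    using dual_vec_in_dual[OF U j'(2)] dual_vec_basis[OF U j'(2,4)] i'(4) by (auto simp: embed_def)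
  moreover have "embed V \<beta> d \<beta>' (dual_vec V \<beta>' d') = (if (\<beta>, d) = (\<beta>', d') then 1 else 0)"
    using dual_vec_in_dual[OF V j'(3)] dual_vec_basis[OF V j'(3,5)] i'(5) by (auto simp: embed_def)
  ultimately show ?thesis by (auto simp: i'(1) j'(1) otimes_def basis_tensor_def)
qed

lemma sum_basis_strings:
  assumes U: "finite_type \<pi> U" and V: "finite_type \<rho> V"
  shows "(\<Sum>i\<in>basis_strings \<pi> U \<rho> V a b. \<phi> i) =
    (\<Sum>s\<in>strings \<pi> U \<rho> V a b. \<Sum>e\<in>basis_at U (fst s). \<Sum>e'\<in>basis_at V (snd s). \<phi> (s, (e, e')))"
proof -
  let ?S = "strings \<pi> U \<rho> V a b" and ?B = "\<lambda>(\<alpha>, \<beta>). basis_at U \<alpha> \<times> basis_at V \<beta>"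
  have "finite (basis_at U \<alpha> \<times> basis_at V \<beta>)" if "(\<alpha>, \<beta>) \<in> ?S" for \<alpha> \<beta>
    using that fin_dim.basis(3)[OF finite_type_fin_dim[OF U]] fin_dim.basis(3)[OF finite_type_fin_dim[OF V]]
    by (simp add: strings_def)
  then have "(\<Sum>s\<in>?S. \<Sum>p\<in>?B s. \<phi> (s, p)) = (\<Sum>(s, p)\<in>Sigma ?S ?B. \<phi> (s, p))"
    by (intro sum.Sigma finite_basis_strings[OF U V]) auto
  then show ?thesis
    by (simp add: basis_strings_def split_def sum.cartesian_product)
qed

lemma basis_expand:
  assumes U: "finite_type \<pi> U" and V: "finite_type \<rho> V"
    and t: "t \<in> string_space \<pi> U \<rho> V a b"
  shows "t \<alpha> \<beta> f g = (\<Sum>i\<in>basis_strings \<pi> U \<rho> V a b. coeff2 U V t i * basis_tensor U V i \<alpha> \<beta> f g)"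
proof -
  let ?S = "strings \<pi> U \<rho> V a b" and ?K = "basis_strings \<pi> U \<rho> V a b"
  let ?T = "\<lambda>s. \<Sum>e\<in>basis_at U (fst s). \<Sum>e'\<in>basis_at V (snd s).
     coeff2 U V t (s, (e, e')) * basis_tensor U V (s, (e, e')) \<alpha> \<beta> f g"
  have "(\<Sum>i\<in>?K. coeff2 U V t i * basis_tensor U V i \<alpha> \<beta> f g) = (\<Sum>s\<in>?S. ?T s)"
    by (rule sum_basis_strings[OF U V])
  also have "\<dots> = (\<Sum>s\<in>?S. if s = (\<alpha>, \<beta>) then ?T (\<alpha>, \<beta>) else 0)"
    by (rule sum.cong) (auto simp: basis_tensor_def otimes_def embed_def intro!: sum.neutral split: if_splits)
  also have "\<dots> = (if (\<alpha>, \<beta>) \<in> ?S then ?T (\<alpha>, \<beta>) else 0)"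
    using finite_basis_strings(1)[OF U V] by (simp add: sum.delta)
  also have "\<dots> = t \<alpha> \<beta> f g"
  proof (cases "(\<alpha>, \<beta>) \<in> ?S")
    case True
    then have a: "\<alpha> \<in> Arr \<pi>" and b: "\<beta> \<in> Arr \<rho>" by (auto simp: strings_def)
    have 1: "(\<lambda>f. t \<alpha> \<beta> f g) \<in> bidual (scal U) (fib U \<alpha>)" and 2: "t \<alpha> \<beta> f \<in> bidual (scal V) (fib V \<beta>)" for f g
      using string_space_bidual[OF t] by blast+
    have "t \<alpha> \<beta> f g = (\<Sum>e\<in>basis_at U \<alpha>. t \<alpha> \<beta> (dual_vec U \<alpha> e) g * embed U \<alpha> e \<alpha> f)"
      by (rule bidual_embed_expand[OF U a 1])
    also have "\<dots> = (\<Sum>e\<in>basis_at U \<alpha>. (\<Sum>e'\<in>basis_at V \<beta>. t \<alpha> \<beta> (dual_vec U \<alpha> e) (dual_vec V \<beta> e') * embed V \<beta> e' \<beta> g) * embed U \<alpha> e \<alpha> f)"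
      by (subst bidual_embed_expand[OF V b 2, of "dual_vec U \<alpha> _" g]) (rule refl)
    also have "\<dots> = ?T (\<alpha>, \<beta>)"
      by (simp add: sum_distrib_left basis_tensor_def otimes_def mult_ac)
    finally show ?thesis using True by simp
  qed (use string_space_strings[OF U V t] in auto)
  finally show ?thesis by simp
qed

section \<open>The convolution product as one trace\<close>

text \<open>
  The action of an operator on coordinates; applied to the image under another operator it is the
  product of their matrices.
\<close>

lemma coeff2_apply:
  assumes U: "finite_type \<pi> U" and V: "finite_type \<rho> V"
    and F: "F \<in> Hom2 \<pi> U \<rho> V \<pi>' U' \<rho>' V'" and t: "t \<in> string_space \<pi> U \<rho> V a b"
  shows "coeff2 U' V' (F t) j =
    (\<Sum>i\<in>basis_strings \<pi> U \<rho> V a b. coeff2 U V t i * coeff2 U' V' (F (basis_tensor U V i)) j)"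
proof -
  have "t = (\<lambda>\<alpha> \<beta> f g. \<Sum>i\<in>basis_strings \<pi> U \<rho> V a b. coeff2 U V t i * basis_tensor U V i \<alpha> \<beta> f g)"
    by (intro ext) (rule basis_expand[OF U V t])
  then have "F t = F (\<lambda>\<alpha> \<beta> f g. \<Sum>i\<in>basis_strings \<pi> U \<rho> V a b. coeff2 U V t i * basis_tensor U V i \<alpha> \<beta> f g)"
    by (rule arg_cong[where f = F])
  also have "\<dots> = (\<lambda>\<alpha> \<beta> f g. \<Sum>i\<in>basis_strings \<pi> U \<rho> V a b. coeff2 U V t i * F (basis_tensor U V i) \<alpha> \<beta> f g)"
    by (rule Hom2_sum[OF F, where x = "basis_tensor U V" and c = "coeff2 U V t"])
      (rule string_space_tensor2, rule basis_tensor_in_string_space)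
  finally have 1: "F t = \<dots>" .
  obtain \<alpha> \<beta> e e' where "j = ((\<alpha>, \<beta>), (e, e'))" by (metis surj_pair)
  then show ?thesis by (simp add: 1)
qed

text \<open>
  Apply \<open>F\<close> to \<open>x \<otimes> q\<close>, contract the resulting first factor at \<open>\<alpha>\<close> with the covector \<open>f\<close>, and apply \<open>G\<close>
  to the remaining vector tensored with \<open>r\<close>. This is \<open>G\<^sup>(\<^sup>2\<^sup>3\<^sup>) F\<^sup>(\<^sup>1\<^sup>2\<^sup>) (x \<otimes> q \<otimes> r)\<close> contracted in its
  first factor.
\<close>

definition two_step where
  "two_step F G x q r \<alpha> f = G (otimes (contract (F (otimes x q)) \<alpha> f) r)"

text \<open>
  For a fixed vector \<open>x\<close> in the first factor and a fixed contraction at \<open>\<gamma>\<close>, \<open>h\<close> of the last factor,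
  \<open>G\<^sup>(\<^sup>2\<^sup>3\<^sup>) F\<^sup>(\<^sup>1\<^sup>2\<^sup>)\<close> becomes an endomorphism of \<open>(W \<otimes> W')\<^sub>a\<^sub>b\<close>. This is its matrix.
\<close>

definition two_step_mat where
  "two_step_mat F G W W' x \<gamma> h i =
     coeff2 W W' (\<lambda>\<alpha> \<beta> f g. two_step F G x (lvec W i) (rvec W' i) \<alpha> f \<beta> \<gamma> g h)"

lemma two_step_mat_diag:
  "two_step_mat F G W W' x \<gamma> h (s, e, e') (s, e, e') =
    two_step F G x (embed W (fst s) e) (embed W' (snd s) e') (fst s) (dual_vec W (fst s) e) (snd s) \<gamma> (dual_vec W' (snd s) e') h"
proof -
  obtain \<alpha> \<beta> where "s = (\<alpha>, \<beta>)" by (cases s)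
  then show ?thesis
    by (simp only: two_step_mat_def coeff2.simps lvec.simps rvec.simps fst_conv snd_conv)
qed

text \<open>
  Tracing first over \<open>W\<close> at \<open>\<alpha>\<close> and then over \<open>W'\<close> at \<open>\<beta>\<close>, and summing over all strings \<open>(\<alpha>, \<beta>)\<close> from
  \<open>a\<close> to \<open>b\<close>, is tracing over \<open>(W \<otimes> W')\<^sub>a\<^sub>b\<close>. The outer partial trace is linear, so the
  sum over basis vectors in the inner one can be moved outside. Strings with a zero space
  have an empty basis and contribute nothing.
\<close>

lemma convolution_ptrace:
  assumes W: "finite_type \<rho> W" and W': "finite_type \<rho>' W'"
    and F: "F \<in> Hom2 \<sigma> U \<rho> W \<rho> W \<sigma>' U'" and G: "G \<in> Hom2 \<sigma>' U' \<rho>' W' \<rho>' W' \<sigma>'' U''"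
    and x: "x \<in> loop_space \<sigma> U a"
  shows "convolution \<rho> \<rho>' (ptrace \<rho> W \<sigma>' F) (ptrace \<rho>' W' \<sigma>'' G) a b x \<gamma> h =
    (if \<gamma> \<in> loops \<sigma>'' b then
      \<Sum>i\<in>basis_strings \<rho> W \<rho>' W' a b. two_step_mat F G W W' x \<gamma> h i i else 0)"
proof -
  let ?S = "strings \<rho> W \<rho>' W' a b"
  define P where "P = (\<lambda>\<alpha> \<beta>. ptrace \<rho>' W' \<sigma>'' G \<beta> (ptrace \<rho> W \<sigma>' F \<alpha> x))"
  have P_fold: "ptrace \<rho>' W' \<sigma>'' G \<beta> (ptrace \<rho> W \<sigma>' F \<alpha> x) = P \<alpha> \<beta>" for \<alpha> \<beta>
    by (simp add: P_def)
  have x': "x \<in> hom_space \<sigma> U a a" using x by (simp add: loop_space_eq)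
  have pt: "ptrace \<rho> W \<sigma>' F \<alpha> x = (\<lambda>\<gamma> h. \<Sum>e\<in>basis_at W \<alpha>. contract (F (otimes x (embed W \<alpha> e))) \<alpha> (dual_vec W \<alpha> e) \<gamma> h)"
    and pt_mem: "\<And>e. contract (F (otimes x (embed W \<alpha> e))) \<alpha> (dual_vec W \<alpha> e) \<in> hom_space \<sigma>' U' (tgt \<rho> \<alpha>) (tgt \<rho> \<alpha>)"
    if \<alpha>: "\<alpha> \<in> Arr \<rho>" "src \<rho> \<alpha> = a" for \<alpha>
  proof -
    show m: "contract (F (otimes x (embed W \<alpha> e))) \<alpha> (dual_vec W \<alpha> e) \<in> hom_space \<sigma>' U' (tgt \<rho> \<alpha>) (tgt \<rho> \<alpha>)" for e
      using contract_in_hom_space[OF Hom2_string_space[OF F otimes_in_string_space[OF x' embed_in_hom_space[OF \<alpha>(1), unfolded \<alpha>(2)]]]]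
      .
    have "contract (F (otimes x (embed W \<alpha> e))) \<alpha> (dual_vec W \<alpha> e) \<gamma> h = 0" if "\<gamma> \<notin> loops \<sigma>' (tgt \<rho> \<alpha>)" for e \<gamma> h
      using hom_space_support[OF m[of e]] that unfolding loops_def by blast
    then show "ptrace \<rho> W \<sigma>' F \<alpha> x = (\<lambda>\<gamma> h. \<Sum>e\<in>basis_at W \<alpha>. contract (F (otimes x (embed W \<alpha> e))) \<alpha> (dual_vec W \<alpha> e) \<gamma> h)"
      by (auto simp: ptrace_def fun_eq_iff tensor_vec_otimes Let_def contract_def dual_vec_def)
  qed
  have P: "P \<alpha> \<beta> \<gamma> h = (if \<gamma> \<in> loops \<sigma>'' b then
       \<Sum>e'\<in>basis_at W' \<beta>. \<Sum>e\<in>basis_at W \<alpha>. 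
        two_step F G x (embed W \<alpha> e) (embed W' \<beta> e') \<alpha> (dual_vec W \<alpha> e) \<beta> \<gamma> (dual_vec W' \<beta> e') h else 0)"
    if s: "\<alpha> \<in> Arr \<rho>" "\<beta> \<in> Arr \<rho>'" "src \<rho> \<alpha> = a" "tgt \<rho> \<alpha> = src \<rho>' \<beta>" "tgt \<rho>' \<beta> = b" for \<alpha> \<beta> \<gamma> h
  proof -
    have "G (otimes (ptrace \<rho> W \<sigma>' F \<alpha> x) (embed W' \<beta> e')) =
      (\<lambda>\<beta>' \<gamma> f h. \<Sum>e\<in>basis_at W \<alpha>. 1 * two_step F G x (embed W \<alpha> e) (embed W' \<beta> e') \<alpha> (dual_vec W \<alpha> e) \<beta>' \<gamma> f h)" for e'
    proof -
      have "otimes (ptrace \<rho> W \<sigma>' F \<alpha> x) (embed W' \<beta> e') = (\<lambda>\<beta>' \<gamma> f h. \<Sum>e\<in>basis_at W \<alpha>.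
          1 * otimes (contract (F (otimes x (embed W \<alpha> e))) \<alpha> (dual_vec W \<alpha> e)) (embed W' \<beta> e') \<beta>' \<gamma> f h)"
        unfolding pt[OF s(1,3)] by (simp add: otimes_def sum_distrib_right)
      then show ?thesis
        by (simp only: two_step_def)
          (rule Hom2_sum[OF G, where c = "\<lambda>_. 1"],
           rule string_space_tensor2, rule otimes_in_string_space[OF pt_mem[OF s(1,3)] embed_in_hom_space[OF s(2), folded s(4)]])
    qed
    moreover have "P \<alpha> \<beta> \<gamma> h = (if \<gamma> \<in> loops \<sigma>'' b then
       \<Sum>e'\<in>basis_at W' \<beta>. G (otimes (ptrace \<rho> W \<sigma>' F \<alpha> x) (embed W' \<beta> e')) \<beta> \<gamma> (dual_vec W' \<beta> e') h else 0)"
      unfolding P_def ptrace_def[of \<rho>' W' \<sigma>'' G] Let_def tensor_vec_otimes dual_vec_def[of W'] s(5) ..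
    ultimately show ?thesis by simp
  qed
  have P0: "P \<alpha> \<beta> = 0" if "\<alpha> \<in> Arr \<rho>" "\<beta> \<in> Arr \<rho>'" "src \<rho> \<alpha> = a" "tgt \<rho> \<alpha> = src \<rho>' \<beta>" "tgt \<rho>' \<beta> = b"
      "(\<alpha>, \<beta>) \<notin> ?S" for \<alpha> \<beta>
  proof -
    have "basis_at W \<alpha> = {} \<or> basis_at W' \<beta> = {}"
      using that fin_dim.basis_zero[OF finite_type_fin_dim[OF W that(1)]]
        fin_dim.basis_zero[OF finite_type_fin_dim[OF W' that(2)]] by (auto simp: strings_def)
    then show ?thesis using P[OF that(1-5)] by (auto simp: fun_eq_iff)
  qed
  have "convolution \<rho> \<rho>' (ptrace \<rho> W \<sigma>' F) (ptrace \<rho>' W' \<sigma>'' G) a b x = (\<Sum>(\<alpha>, \<beta>)\<in>?S. P \<alpha> \<beta>)"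
    unfolding convolution_def P_fold
  proof (rule sum.mono_neutral_left)
    show "finite ?S" by (rule finite_basis_strings[OF W W'])
    show "{(\<alpha>, \<beta>). \<alpha> \<in> Arr \<rho> \<and> \<beta> \<in> Arr \<rho>' \<and> src \<rho> \<alpha> = a \<and> tgt \<rho> \<alpha> = src \<rho>' \<beta> \<and> tgt \<rho>' \<beta> = b \<and> P \<alpha> \<beta> \<noteq> 0} \<subseteq> ?S"
      using P0 by blast
  qed (auto simp: strings_def)
  then have "convolution \<rho> \<rho>' (ptrace \<rho> W \<sigma>' F) (ptrace \<rho>' W' \<sigma>'' G) a b x \<gamma> h = (\<Sum>s\<in>?S. P (fst s) (snd s) \<gamma> h)"
    by (simp add: sum_fun_apply split_def)
  also have "\<dots> = (\<Sum>s\<in>?S. if \<gamma> \<in> loops \<sigma>'' b then \<Sum>e\<in>basis_at W (fst s). \<Sum>e'\<in>basis_at W' (snd s).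
        two_step F G x (embed W (fst s) e) (embed W' (snd s) e') (fst s) (dual_vec W (fst s) e) (snd s) \<gamma> (dual_vec W' (snd s) e') h else 0)"
  proof (rule sum.cong)
    fix s assume "s \<in> ?S"
    then have s: "fst s \<in> Arr \<rho>" "snd s \<in> Arr \<rho>'" "src \<rho> (fst s) = a" "tgt \<rho> (fst s) = src \<rho>' (snd s)"
        "tgt \<rho>' (snd s) = b"
      by (simp_all add: strings_def split_def)
    show "P (fst s) (snd s) \<gamma> h = (if \<gamma> \<in> loops \<sigma>'' b then \<Sum>e\<in>basis_at W (fst s). \<Sum>e'\<in>basis_at W' (snd s).
        two_step F G x (embed W (fst s) e) (embed W' (snd s) e') (fst s) (dual_vec W (fst s) e) (snd s) \<gamma> (dual_vec W' (snd s) e') h else 0)"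
      unfolding P[OF s] sum.swap[of _ "basis_at W' (snd s)" "basis_at W (fst s)"] ..
  qed simp
  also have "\<dots> = (if \<gamma> \<in> loops \<sigma>'' b then
      \<Sum>i\<in>basis_strings \<rho> W \<rho>' W' a b. two_step_mat F G W W' x \<gamma> h i i else 0)"
    unfolding sum_basis_strings[OF W W']
    by (simp add: two_step_mat_diag)
  finally show ?thesis .
qed

text \<open>
  Cyclicity of the trace: if \<open>M D = D N\<close> and \<open>E\<close> is inverse to \<open>D\<close>, then
  \<open>tr M = tr (M D E) = tr (D N E) = tr (N E D) = tr N\<close>. The matrices are indexed by different sets, and
  it is the two-sided invertibility of \<open>D\<close> that allows both of them to disappear.
\<close>

lemma trace_eq_of_intertwining:
  fixes M D E N :: "_ \<Rightarrow> _ \<Rightarrow> 'c::comm_ring_1"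
  assumes "finite I" "finite J"
    and MD: "\<And>i k. i \<in> I \<Longrightarrow> k \<in> J \<Longrightarrow> (\<Sum>j\<in>I. M i j * D j k) = (\<Sum>l\<in>J. D i l * N l k)"
    and DE: "\<And>i j. i \<in> I \<Longrightarrow> j \<in> I \<Longrightarrow> (\<Sum>k\<in>J. D i k * E k j) = (if i = j then 1 else 0)"
    and ED: "\<And>k l. k \<in> J \<Longrightarrow> l \<in> J \<Longrightarrow> (\<Sum>i\<in>I. E k i * D i l) = (if k = l then 1 else 0)"
  shows "(\<Sum>i\<in>I. M i i) = (\<Sum>k\<in>J. N k k)"
proof -
  have "(\<Sum>i\<in>I. M i i) = (\<Sum>i\<in>I. \<Sum>j\<in>I. M i j * (if j = i then 1 else 0))"
    using \<open>finite I\<close> by (simp add: if_distrib sum.delta cong: if_cong)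
  also have "\<dots> = (\<Sum>i\<in>I. \<Sum>j\<in>I. M i j * (\<Sum>k\<in>J. D j k * E k i))"
    by (intro sum.cong refl) (simp add: DE)
  also have "\<dots> = (\<Sum>i\<in>I. \<Sum>k\<in>J. (\<Sum>j\<in>I. M i j * D j k) * E k i)"
    by (simp add: sum_distrib_left sum_distrib_right mult_ac) (intro sum.cong refl, rule sum.swap)
  also have "\<dots> = (\<Sum>i\<in>I. \<Sum>k\<in>J. (\<Sum>l\<in>J. D i l * N l k) * E k i)"
    by (intro sum.cong refl) (simp add: MD)
  also have "\<dots> = (\<Sum>k\<in>J. \<Sum>i\<in>I. \<Sum>l\<in>J. N l k * (E k i * D i l))"
    by (subst sum.swap) (simp add: sum_distrib_left sum_distrib_right mult_ac)
  also have "\<dots> = (\<Sum>k\<in>J. \<Sum>l\<in>J. N l k * (\<Sum>i\<in>I. E k i * D i l))"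
    by (simp add: sum_distrib_left) (intro sum.cong refl, rule sum.swap)
  also have "\<dots> = (\<Sum>k\<in>J. \<Sum>l\<in>J. N l k * (if k = l then 1 else 0))"
    by (intro sum.cong refl) (simp add: ED)
  also have "\<dots> = (\<Sum>k\<in>J. N k k)"
    using \<open>finite J\<close> by (simp add: if_distrib sum.delta cong: if_cong)
  finally show ?thesis .
qed

section \<open>Identities on dense open sets\<close>

lemma generically_conj: "generically P \<Longrightarrow> generically Q \<Longrightarrow> generically (\<lambda>p. P p \<and> Q p)"
proof -
  assume "generically P" "generically Q"
  then obtain U V where "open U" "closure U = UNIV" "\<forall>p\<in>U. P p" "open V" "closure V = UNIV" "\<forall>p\<in>V. Q p"
    unfolding generically_def by blast
  moreover have "closure (U \<inter> V) = UNIV"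
    using calculation open_Int_closure_subset[of U V] closure_minimal[of U "closure (U \<inter> V)"] by auto
  ultimately show ?thesis unfolding generically_def by (intro exI[of _ "U \<inter> V"]) auto
qed

lemma generically_ball_finite:
  "finite A \<Longrightarrow> (\<And>x. x \<in> A \<Longrightarrow> generically (P x)) \<Longrightarrow> generically (\<lambda>p. \<forall>x\<in>A. P x p)"
proof (induction A rule: finite_induct)
  case empty
  show ?case unfolding generically_def by (intro exI[of _ UNIV]) auto
next
  case (insert x A)
  then show ?case using generically_conj[of "P x" "\<lambda>p. \<forall>x\<in>A. P x p"] by simp
qed

lemma generically_mono: "generically P \<Longrightarrow> (\<And>p. P p \<Longrightarrow> Q p) \<Longrightarrow> generically Q"
  unfolding generically_def by blast

lemma generically_snd:
  "generically P \<Longrightarrow> generically (\<lambda>p :: 'a::topological_space \<times> 'b::topological_space. P (snd p))"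
  unfolding generically_def
  by (elim exE, rule_tac x = "UNIV \<times> U" in exI) (auto simp: open_Times closure_Times)

text \<open>
  Identities in the parameters of the intertwining relation are to be read as identities in those of
  the partial traces, which amounts to a linear change of coordinates.
\<close>

lemma generically_homeomorphism:
  assumes "generically P" "continuous_on UNIV h" "continuous_on UNIV h'" "\<And>p. h (h' p) = p" "\<And>p. h' (h p) = p"
  shows "generically (\<lambda>p. P (h p))"
proof -
  obtain U where U: "open U" "closure U = UNIV" "\<forall>p\<in>U. P p" using assms(1) unfolding generically_def by blast
  have "open (h -` U)" using U(1) assms(2) by (metis open_vimage)
  moreover have "h' ` closure U \<subseteq> closure (h' ` U)"
    using assms(3) by (intro image_closure_subset) (auto simp: closure_subset intro: continuous_on_subset)
  moreover have "h' ` U = h -` U" using assms(4,5) by (auto simp: image_iff) metis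
  moreover have "range h' = UNIV" using assms(5) by (metis surjI)
  ultimately show ?thesis unfolding generically_def using U by (intro exI[of _ "h -` U"]) auto
qed

section \<open>Operators on three factors\<close>

definition otimes3 :: "('a, 'u) ten1 \<Rightarrow> ('b, 'v) ten1 \<Rightarrow> ('c, 'w) ten1 \<Rightarrow> ('a, 'u, 'b, 'v, 'c, 'w) ten3" where
  "otimes3 x y z = (\<lambda>\<alpha> \<beta> \<gamma> f g h. x \<alpha> f * y \<beta> g * z \<gamma> h)"

lemma otimes3_in_tensor3:
  assumes x: "x \<in> hom_space \<pi> U a c" and y: "y \<in> hom_space \<rho> V c d" and z: "z \<in> hom_space \<sigma> W d b"
  shows "otimes3 x y z \<in> tensor3 \<pi> U \<rho> V \<sigma> W"
proof -
  have "otimes3 x y z \<alpha> \<beta> \<gamma> = 0" if "x \<alpha> = 0 \<or> y \<beta> = 0 \<or> z \<gamma> = 0" for \<alpha> \<beta> \<gamma>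
    using that by (auto simp: otimes3_def fun_eq_iff)
  then have "{(\<alpha>, \<beta>, \<gamma>). otimes3 x y z \<alpha> \<beta> \<gamma> \<noteq> 0} \<subseteq> {\<alpha>. x \<alpha> \<noteq> 0} \<times> {\<beta>. y \<beta> \<noteq> 0} \<times> {\<gamma>. z \<gamma> \<noteq> 0}"
    by blast
  moreover have "finite \<dots>" using x y z by (auto simp: hom_space_iff)
  ultimately have fin: "finite {(\<alpha>, \<beta>, \<gamma>). otimes3 x y z \<alpha> \<beta> \<gamma> \<noteq> 0}" by (rule finite_subset)
  have 1: "(\<lambda>f. otimes3 x y z \<alpha> \<beta> \<gamma> f g h) \<in> bidual (scal U) (fib U \<alpha>)" for \<alpha> \<beta> \<gamma> g h
    using bidual_scale[of "x \<alpha>" "scal U" "fib U \<alpha>" "y \<beta> g * z \<gamma> h"] x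
    by (simp add: otimes3_def hom_space_iff mult_ac)
  have 2: "(\<lambda>g. otimes3 x y z \<alpha> \<beta> \<gamma> f g h) \<in> bidual (scal V) (fib V \<beta>)" for \<alpha> \<beta> \<gamma> f h
    using bidual_scale[of "y \<beta>" "scal V" "fib V \<beta>" "x \<alpha> f * z \<gamma> h"] y
    by (simp add: otimes3_def hom_space_iff mult_ac)
  have 3: "(\<lambda>h. otimes3 x y z \<alpha> \<beta> \<gamma> f g h) \<in> bidual (scal W) (fib W \<gamma>)" for \<alpha> \<beta> \<gamma> f g
    using bidual_scale[of "z \<gamma>" "scal W" "fib W \<gamma>" "x \<alpha> f * y \<beta> g"] z
    by (simp add: otimes3_def hom_space_iff mult_ac)
  have 4: "otimes3 x y z \<alpha> \<beta> \<gamma> = 0"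
    if "\<not> (\<alpha> \<in> Arr \<pi> \<and> \<beta> \<in> Arr \<rho> \<and> \<gamma> \<in> Arr \<sigma> \<and> tgt \<pi> \<alpha> = src \<rho> \<beta> \<and> tgt \<rho> \<beta> = src \<sigma> \<gamma>)" for \<alpha> \<beta> \<gamma>
  proof (rule ccontr)
    assume "otimes3 x y z \<alpha> \<beta> \<gamma> \<noteq> 0"
    then obtain f g h where "otimes3 x y z \<alpha> \<beta> \<gamma> f g h \<noteq> 0" by (auto simp: fun_eq_iff)
    then have "x \<alpha> f \<noteq> 0" "y \<beta> g \<noteq> 0" "z \<gamma> h \<noteq> 0" by (auto simp: otimes3_def)
    then show False
      using that hom_space_support[OF x] hom_space_support[OF y] hom_space_support[OF z] by simp
  qed
  show ?thesis
    unfolding tensor3_def mem_Collect_eq using fin 1 2 3 4 by simp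
qed

text \<open>
  On products of three vectors the operator \<open>F\<^sup>(\<^sup>1\<^sup>2\<^sup>)\<close> acts on the first two of them, so that
  \<open>G\<^sup>(\<^sup>2\<^sup>3\<^sup>)\<close> meets, after contraction of the first factor, a product of two vectors again. Sums
  are included because applying \<open>D\<^sup>(\<^sup>2\<^sup>3\<^sup>)\<close> first turns a product into a sum of products.
\<close>

lemma op12_op23_sum:
  assumes F: "F \<in> Hom2 \<sigma> U \<rho> W \<rho> W \<sigma>' U'" and G: "G \<in> Hom2 \<sigma>' U' \<rho>' W' \<rho>'' W'' \<sigma>'' U''"
    and x: "x \<in> hom_space \<sigma> U a a"
    and qr: "\<And>k. k \<in> K \<Longrightarrow> \<exists>c. q k \<in> hom_space \<rho> W a c \<and> r k \<in> hom_space \<rho>' W' c b"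
  shows "op23 G (op12 F (\<lambda>\<alpha> \<beta> \<gamma> f g h. \<Sum>k\<in>K. c k * otimes3 x (q k) (r k) \<alpha> \<beta> \<gamma> f g h)) =
    (\<lambda>\<alpha> \<beta> \<gamma> f g h. \<Sum>k\<in>K. c k * two_step F G x (q k) (r k) \<alpha> f \<beta> \<gamma> g h)"
proof -
  have xq: "otimes x (q k) \<in> tensor2 \<sigma> U \<rho> W" if k: "k \<in> K" for k
  proof -
    obtain c where "q k \<in> hom_space \<rho> W a c" using qr[OF k] by blast
    then show ?thesis by (rule string_space_tensor2[OF otimes_in_string_space[OF x]])
  qed
  have "F (\<lambda>\<alpha> \<beta> f g. \<Sum>k\<in>K. c k * otimes3 x (q k) (r k) \<alpha> \<beta> \<gamma> f g h) =
      (\<lambda>\<alpha> \<beta> f g. \<Sum>k\<in>K. c k * r k \<gamma> h * F (otimes x (q k)) \<alpha> \<beta> f g)" for \<gamma> h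
    using Hom2_sum[OF F, where I = K and x = "\<lambda>k. otimes x (q k)" and c = "\<lambda>k. c k * r k \<gamma> h"] xq
    by (simp add: otimes3_def otimes_def mult_ac)
  then have 1: "op12 F (\<lambda>\<alpha> \<beta> \<gamma> f g h. \<Sum>k\<in>K. c k * otimes3 x (q k) (r k) \<alpha> \<beta> \<gamma> f g h) =
      (\<lambda>\<alpha> \<beta> \<gamma> f g h. \<Sum>k\<in>K. c k * otimes (contract (F (otimes x (q k))) \<alpha> f) (r k) \<beta> \<gamma> g h)"
    by (simp add: op12_def otimes_def contract_def mult_ac)
  have xqr: "otimes (contract (F (otimes x (q k))) \<alpha> f) (r k) \<in> tensor2 \<sigma>' U' \<rho>' W'" if k: "k \<in> K" for k \<alpha> f
  proof -
    obtain c where c: "q k \<in> hom_space \<rho> W a c" "r k \<in> hom_space \<rho>' W' c b" using qr[OF k] by blast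
    show ?thesis
      by (rule string_space_tensor2[OF otimes_in_string_space[OF contract_in_hom_space[OF
          Hom2_string_space[OF F otimes_in_string_space[OF x c(1)]]] c(2)]])
  qed
  have "G (\<lambda>\<beta> \<gamma> g h. \<Sum>k\<in>K. c k * otimes (contract (F (otimes x (q k))) \<alpha> f) (r k) \<beta> \<gamma> g h) =
    (\<lambda>\<beta> \<gamma> g h. \<Sum>k\<in>K. c k * two_step F G x (q k) (r k) \<alpha> f \<beta> \<gamma> g h)" for \<alpha> f
    unfolding two_step_def
    by (rule Hom2_sum[OF G, where c = c and x = "\<lambda>k. otimes (contract (F (otimes x (q k))) \<alpha> f) (r k)"]) (rule xqr)
  then show ?thesis unfolding 1 by (simp add: op23_def)
qed

text \<open>
  Needed in order to apply a third operator to the two first factors and to expand in the basis of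
  \<open>(W \<otimes> W')\<^sub>a\<^sub>b\<close>. Linearity in the first covector goes through \<open>G\<close>.
  If \<open>\<gamma>\<close> is a loop at \<open>b\<close>, preservation of end points by \<open>F\<close> and \<open>G\<close> forces the strings \<open>\<alpha>\<close>, \<open>\<beta>\<close> to
  run from \<open>a\<close> to \<open>b\<close>.
\<close>

lemma two_step_slice:
  assumes W: "finite_type \<rho> W" and W': "finite_type \<rho>' W'"
    and F: "F \<in> Hom2 \<sigma> U \<rho> W \<rho> W \<sigma>' U'" and G: "G \<in> Hom2 \<sigma>' U' \<rho>' W' \<rho>' W' \<sigma>'' U''"
    and x: "x \<in> hom_space \<sigma> U a a" and q: "q \<in> hom_space \<rho> W a c" and r: "r \<in> hom_space \<rho>' W' c b"
    and \<gamma>: "\<gamma> \<in> loops \<sigma>'' b"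
  shows "(\<lambda>\<alpha> \<beta> f g. two_step F G x q r \<alpha> f \<beta> \<gamma> g h) \<in> string_space \<rho> W \<rho>' W' a b"
proof -
  let ?p = "\<lambda>\<alpha> f. contract (F (otimes x q)) \<alpha> f"
  have Fx: "F (otimes x q) \<in> string_space \<rho> W \<sigma>' U' a c"
    by (rule Hom2_string_space[OF F otimes_in_string_space[OF x q]])
  have pr: "otimes (?p \<alpha> f) r \<in> string_space \<sigma>' U' \<rho>' W' (tgt \<rho> \<alpha>) b" for \<alpha> f
    by (rule otimes_in_string_space[OF contract_in_hom_space[OF Fx] r])
  have Gp: "two_step F G x q r \<alpha> f \<in> string_space \<rho>' W' \<sigma>'' U'' (tgt \<rho> \<alpha>) b" for \<alpha> f
    unfolding two_step_def by (rule Hom2_string_space[OF G pr])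
  have G0: "two_step F G x q r \<alpha> f = (\<lambda>\<alpha> \<beta> f g. 0)" if "?p \<alpha> f = (\<lambda>\<beta> g. 0)" for \<alpha> f
    using Hom2_sum[OF G, of "{}"] that by (simp add: two_step_def otimes_def)
  show ?thesis
  proof (rule string_spaceI[OF W W'])
    fix \<alpha> \<beta> g
    show "(\<lambda>f. two_step F G x q r \<alpha> f \<beta> \<gamma> g h) \<in> bidual (scal W) (fib W \<alpha>)"
    proof (rule bidualI)
      fix k f f' assume f: "f \<in> dual (scal W) (fib W \<alpha>)" "f' \<in> dual (scal W) (fib W \<alpha>)"
      have "?p \<alpha> (\<lambda>u. k * f u + f' u) \<beta> g = k * ?p \<alpha> f \<beta> g + ?p \<alpha> f' \<beta> g" for \<beta> g
        unfolding contract_def by (rule bidual_comb[OF string_space_bidual(1)[OF Fx] f])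
      \<comment> \<open>The combination of two tensors is written as a sum over the truth values, to which linearity of
      \<open>G\<close> on finite sums applies.\<close>
      then have "otimes (?p \<alpha> (\<lambda>u. k * f u + f' u)) r =
          (\<lambda>\<beta> \<gamma> g h. \<Sum>b\<in>UNIV. (if b then k else 1) * otimes (?p \<alpha> (if b then f else f')) r \<beta> \<gamma> g h)"
        by (simp add: otimes_def UNIV_bool algebra_simps)
      then have "two_step F G x q r \<alpha> (\<lambda>u. k * f u + f' u) =
          (\<lambda>\<beta> \<gamma> g h. \<Sum>b\<in>UNIV. (if b then k else 1) * two_step F G x q r \<alpha> (if b then f else f') \<beta> \<gamma> g h)"
        unfolding two_step_def by (simp only:)
          (rule Hom2_sum[OF G, where c = "\<lambda>b. if b then k else 1" and
              x = "\<lambda>b. otimes (?p \<alpha> (if b then f else f')) r"], rule string_space_tensor2[OF pr])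
      then show "two_step F G x q r \<alpha> (\<lambda>u. k * f u + f' u) \<beta> \<gamma> g h =
          k * two_step F G x q r \<alpha> f \<beta> \<gamma> g h + two_step F G x q r \<alpha> f' \<beta> \<gamma> g h"
        by (simp add: UNIV_bool)
    next
      fix f assume "f \<notin> dual (scal W) (fib W \<alpha>)"
      then have "?p \<alpha> f = (\<lambda>\<beta> g. 0)"
        using bidual_outside[OF string_space_bidual(1)[OF Fx]] by (simp add: contract_def fun_eq_iff)
      then show "two_step F G x q r \<alpha> f \<beta> \<gamma> g h = 0" by (simp add: G0)
    qed
  next
    fix \<alpha> \<beta> f
    show "(\<lambda>g. two_step F G x q r \<alpha> f \<beta> \<gamma> g h) \<in> bidual (scal W') (fib W' \<beta>)"
      by (rule string_space_bidual(1)[OF Gp])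
  next
    fix \<alpha> \<beta> f g assume nz: "two_step F G x q r \<alpha> f \<beta> \<gamma> g h \<noteq> 0"
    then have "?p \<alpha> f \<noteq> (\<lambda>\<beta> g. 0)" using G0 by fastforce
    then obtain \<beta>' g' where "F (otimes x q) \<alpha> \<beta>' f g' \<noteq> 0" by (auto simp: contract_def fun_eq_iff)
    then show "\<alpha> \<in> Arr \<rho> \<and> \<beta> \<in> Arr \<rho>' \<and> tgt \<rho> \<alpha> = src \<rho>' \<beta> \<and> src \<rho> \<alpha> = a \<and> tgt \<rho>' \<beta> = b"
      using string_space_support[OF Fx] string_space_support[OF Gp, OF nz] \<gamma> by (simp add: loops_def)
  qed
qed

section \<open>Commutation of the convolution product\<close>

text \<open>
  The statement at one choice of the parameters: \<open>R1\<close>, \<open>R2\<close> are taken at \<open>z\<close>, \<open>C\<close> at \<open>z'\<close>, and \<open>D\<close>, \<open>E\<close> are the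
  values of \<open>C\<close> and of its inverse at the auxiliary parameter. Only finitely many vectors, the basis
  tensors from \<open>a\<close> to \<open>b\<close>, enter into the assumptions; this makes it possible to find
  parameters where all of them hold.
\<close>

lemma convolution_commute:
  assumes V1: "finite_type \<pi>1 V1" and V2: "finite_type \<pi>2 V2" and V: "finite_type \<pi> V"
    and R1: "R1 \<in> Hom2 \<pi>1 V1 \<pi>1 V1 \<pi>1 V1 \<pi>1 V1" and R2: "R2 \<in> Hom2 \<pi>2 V2 \<pi>2 V2 \<pi>2 V2 \<pi>2 V2"
    and C: "C \<in> Hom2 \<pi>1 V1 \<pi> V \<pi> V \<pi>2 V2" and D: "D \<in> Hom2 \<pi>1 V1 \<pi> V \<pi> V \<pi>2 V2"
    and E: "E \<in> Hom2 \<pi> V \<pi>2 V2 \<pi>1 V1 \<pi> V" and x: "x \<in> loop_space \<pi>1 V1 a"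
    and ED: "\<And>i. i \<in> basis_strings \<pi>1 V1 \<pi> V a b \<Longrightarrow> E (D (basis_tensor V1 V i)) = basis_tensor V1 V i"
    and DE: "\<And>k. k \<in> basis_strings \<pi> V \<pi>2 V2 a b \<Longrightarrow> D (E (basis_tensor V V2 k)) = basis_tensor V V2 k"
    and intertwine: "\<And>i. i \<in> basis_strings \<pi>1 V1 \<pi> V a b \<Longrightarrow>
      op12 D (op23 C (op12 R1 (otimes3 x (lvec V1 i) (rvec V i)))) =
      op23 R2 (op12 C (op23 D (otimes3 x (lvec V1 i) (rvec V i))))"
  shows "convolution \<pi>1 \<pi> (ptrace \<pi>1 V1 \<pi>1 R1) (ptrace \<pi> V \<pi>2 C) a b x =
    convolution \<pi> \<pi>2 (ptrace \<pi> V \<pi>2 C) (ptrace \<pi>2 V2 \<pi>2 R2) a b x"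
proof (intro ext)
  fix \<gamma> h
  let ?I = "basis_strings \<pi>1 V1 \<pi> V a b" and ?J = "basis_strings \<pi> V \<pi>2 V2 a b"
  let ?M = "two_step_mat R1 C V1 V x \<gamma> h" and ?N = "two_step_mat C R2 V V2 x \<gamma> h"
  let ?D = "\<lambda>i k. coeff2 V V2 (D (basis_tensor V1 V i)) k"
  let ?E = "\<lambda>k i. coeff2 V1 V (E (basis_tensor V V2 k)) i"
  have x': "x \<in> hom_space \<pi>1 V1 a a" using x by (simp add: loop_space_eq)
  have Dbt: "D (basis_tensor V1 V i) \<in> string_space \<pi> V \<pi>2 V2 a b" if "i \<in> ?I" for i
    by (rule Hom2_string_space[OF D basis_tensor_in_string_space[OF that]])
  have Ebt: "E (basis_tensor V V2 k) \<in> string_space \<pi>1 V1 \<pi> V a b" if "k \<in> ?J" for k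
    by (rule Hom2_string_space[OF E basis_tensor_in_string_space[OF that]])
  have "(\<Sum>i\<in>?I. ?M i i) = (\<Sum>k\<in>?J. ?N k k)" if \<gamma>: "\<gamma> \<in> loops \<pi>2 b"
  proof (rule trace_eq_of_intertwining[where M = ?M and N = ?N and D = ?D and E = ?E])
    show "finite ?I" "finite ?J" by (rule finite_basis_strings[OF V1 V] finite_basis_strings[OF V V2])+
  next
    fix i j assume i: "i \<in> ?I" and j: "j \<in> ?I"
    show "(\<Sum>k\<in>?J. ?D i k * ?E k j) = (if i = j then 1 else 0)"
      unfolding coeff2_apply[OF V V2 E Dbt[OF i], symmetric] ED[OF i] by (rule basis_tensor_coeff[OF V1 V i j])
  next
    fix k l assume k: "k \<in> ?J" and l: "l \<in> ?J"
    show "(\<Sum>i\<in>?I. ?E k i * ?D i l) = (if k = l then 1 else 0)"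
      unfolding coeff2_apply[OF V1 V D Ebt[OF k], symmetric] DE[OF k] by (rule basis_tensor_coeff[OF V V2 k l])
  next
    fix i k assume i: "i \<in> ?I" and k: "k \<in> ?J"
    let ?X = "otimes3 x (lvec V1 i) (rvec V i)"
    let ?T = "\<lambda>\<alpha> \<beta> f g. two_step R1 C x (lvec V1 i) (rvec V i) \<alpha> f \<beta> \<gamma> g h"
    obtain c where c: "lvec V1 i \<in> hom_space \<pi>1 V1 a c" "rvec V i \<in> hom_space \<pi> V c b"
      using i by (rule basis_vecs)
    have T: "?T \<in> string_space \<pi>1 V1 \<pi> V a b"
      by (rule two_step_slice[OF V1 V R1 C x' c \<gamma>])
    \<comment> \<open>The outermost operator \<open>D\<close> on the left side acts on \<open>?T\<close>, which is why \<open>?T\<close> has to be a tensor.\<close>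
    have "op23 C (op12 R1 ?X) = (\<lambda>\<alpha> \<beta> \<gamma> f g h. two_step R1 C x (lvec V1 i) (rvec V i) \<alpha> f \<beta> \<gamma> g h)"
      using op12_op23_sum[OF R1 C x', of "{i}" "lvec V1" "rvec V" b "\<lambda>_. 1"] c by auto
    then have L: "op12 D (op23 C (op12 R1 ?X)) \<alpha> \<beta> \<gamma> f g h = D ?T \<alpha> \<beta> f g" for \<alpha> \<beta> f g
      by (simp add: op12_def)
    \<comment> \<open>The right side becomes a combination of products \<open>x \<otimes> q \<otimes> r\<close>, one for each basis tensor of \<open>V \<otimes> V2\<close>.\<close>
    have "op23 D ?X = (\<lambda>\<alpha> \<beta> \<gamma> f g h. x \<alpha> f * D (basis_tensor V1 V i) \<beta> \<gamma> g h)"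
      using graded_maps_scale[OF D[unfolded Hom2_def], OF string_space_tensor2[OF basis_tensor_in_string_space[OF i]]]
      by (simp add: op23_def otimes3_def basis_tensor_def otimes_def mult.assoc)
    also have "\<dots> = (\<lambda>\<alpha> \<beta> \<gamma> f g h. \<Sum>k\<in>?J. ?D i k * otimes3 x (lvec V k) (rvec V2 k) \<alpha> \<beta> \<gamma> f g h)"
      by (intro ext, subst basis_expand[OF V V2 Dbt[OF i]])
        (simp add: sum_distrib_left otimes3_def basis_tensor_def otimes_def mult_ac)
    finally have "op23 R2 (op12 C (op23 D ?X)) =
       (\<lambda>\<alpha> \<beta> \<gamma> f g h. \<Sum>k\<in>?J. ?D i k * two_step C R2 x (lvec V k) (rvec V2 k) \<alpha> f \<beta> \<gamma> g h)"
      by (simp only:) (rule op12_op23_sum[OF C R2 x', where b = b], meson basis_vecs)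
    then have DT: "D ?T = (\<lambda>\<alpha> \<beta> f g. \<Sum>k\<in>?J. ?D i k * two_step C R2 x (lvec V k) (rvec V2 k) \<alpha> f \<beta> \<gamma> g h)"
      using L intertwine[OF i] by (simp add: fun_eq_iff)
    \<comment> \<open>The left side of the intertwining relation is now read off in coordinates.\<close>
    have "(\<Sum>j\<in>?I. ?M i j * ?D j k) = coeff2 V V2 (D ?T) k"
      unfolding two_step_mat_def by (rule coeff2_apply[OF V1 V D T, symmetric])
    also have "\<dots> = (\<Sum>l\<in>?J. ?D i l * ?N l k)"
    proof -
      obtain \<alpha> \<beta> e e' where "k = ((\<alpha>, \<beta>), (e, e'))" by (metis surj_pair)
      then show ?thesis by (simp add: DT two_step_mat_def)
    qed
    finally show "(\<Sum>j\<in>?I. ?M i j * ?D j k) = (\<Sum>l\<in>?J. ?D i l * ?N l k)" .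
  qed
  then show "convolution \<pi>1 \<pi> (ptrace \<pi>1 V1 \<pi>1 R1) (ptrace \<pi> V \<pi>2 C) a b x \<gamma> h =
    convolution \<pi> \<pi>2 (ptrace \<pi> V \<pi>2 C) (ptrace \<pi>2 V2 \<pi>2 R2) a b x \<gamma> h"
    using convolution_ptrace[OF V1 V R1 C x, of b \<gamma> h] convolution_ptrace[OF V V2 C R2 x, of b \<gamma> h] by simp
qed

theorem proposition3p27:
  fixes \<pi>1 :: "('o1, 'e1) groupoid" and \<pi>2 :: "('o2, 'e2) groupoid" and \<pi> :: "('o1, 'o2, 'e) arrows"
    and V1 :: "('e1, 'v1::ab_group_add) vfamily" and V2 :: "('e2, 'v2::ab_group_add) vfamily"
    and V :: "('e, 'v::ab_group_add) vfamily"
    and R1 :: "complex \<Rightarrow> ('e1, 'v1, 'e1, 'v1) ten2 \<Rightarrow> ('e1, 'v1, 'e1, 'v1) ten2"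
    and R2 :: "complex \<Rightarrow> ('e2, 'v2, 'e2, 'v2) ten2 \<Rightarrow> ('e2, 'v2, 'e2, 'v2) ten2"
    and C :: "complex \<Rightarrow> ('e1, 'v1, 'e, 'v) ten2 \<Rightarrow> ('e, 'v, 'e2, 'v2) ten2"
  assumes "is_groupoid \<pi>1" and "finite_type \<pi>1 V1" and "yang_baxter_operator \<pi>1 V1 R1"
    and "is_groupoid \<pi>2" and "finite_type \<pi>2 V2" and "yang_baxter_operator \<pi>2 V2 R2"
    and "connecting_set \<pi>1 \<pi>2 \<pi>" and "finite_type \<pi> V"
    and "intertwiner \<pi>1 V1 \<pi>2 V2 \<pi> V R1 R2 C"
    and "\<exists>Cinv. (\<forall>z. Cinv z \<in> Hom2 \<pi> V \<pi>2 V2 \<pi>1 V1 \<pi> V) \<and>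
                mero_eq (tensor2 \<pi> V \<pi>2 V2) (\<lambda>z. C z \<circ> Cinv z) (\<lambda>z. id) \<and>
                mero_eq (tensor2 \<pi>1 V1 \<pi> V) (\<lambda>z. Cinv z \<circ> C z) (\<lambda>z. id)"
  shows "\<forall>a\<in>Ob \<pi>1. \<forall>b\<in>Ob \<pi>2.
    mero_eq (loop_space \<pi>1 V1 a)
      (\<lambda>(z, z'). convolution \<pi>1 \<pi> (ptrace \<pi>1 V1 \<pi>1 (R1 z)) (ptrace \<pi> V \<pi>2 (C z')) a b)
      (\<lambda>(z, z'). convolution \<pi> \<pi>2 (ptrace \<pi> V \<pi>2 (C z')) (ptrace \<pi>2 V2 \<pi>2 (R2 z)) a b)"
proof (intro ballI)
  fix a b assume "a \<in> Ob \<pi>1" "b \<in> Ob \<pi>2"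
  note V1 = \<open>finite_type \<pi>1 V1\<close> and V2 = \<open>finite_type \<pi>2 V2\<close> and V = \<open>finite_type \<pi> V\<close>
  let ?I = "basis_strings \<pi>1 V1 \<pi> V a b" and ?J = "basis_strings \<pi> V \<pi>2 V2 a b"
  have R1: "R1 z \<in> Hom2 \<pi>1 V1 \<pi>1 V1 \<pi>1 V1 \<pi>1 V1" for z
    using assms(3) End2_subset_Hom2[OF assms(1), of V1] unfolding yang_baxter_operator_def meromorphic_family_def by blast
  have R2: "R2 z \<in> Hom2 \<pi>2 V2 \<pi>2 V2 \<pi>2 V2 \<pi>2 V2" for z
    using assms(6) End2_subset_Hom2[OF assms(4), of V2] unfolding yang_baxter_operator_def meromorphic_family_def by blast
  have C: "C z \<in> Hom2 \<pi>1 V1 \<pi> V \<pi> V \<pi>2 V2" for z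
    using assms(9) unfolding intertwiner_def meromorphic_family_def by blast
  obtain E where E: "\<And>z. E z \<in> Hom2 \<pi> V \<pi>2 V2 \<pi>1 V1 \<pi> V"
    and CE: "mero_eq (tensor2 \<pi> V \<pi>2 V2) (\<lambda>z. C z \<circ> E z) (\<lambda>z. id)"
    and EC: "mero_eq (tensor2 \<pi>1 V1 \<pi> V) (\<lambda>z. E z \<circ> C z) (\<lambda>z. id)"
    using assms(10) by blast
  have inter: "mero_eq (tensor3 \<pi>1 V1 \<pi>1 V1 \<pi> V)
       (\<lambda>(z, w). op12 (C w) \<circ> op23 (C z) \<circ> op12 (R1 (z - w)))
       (\<lambda>(z, w). op23 (R2 (z - w)) \<circ> op12 (C z) \<circ> op23 (C w))"
    using assms(9) unfolding intertwiner_def by blast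
  show "mero_eq (loop_space \<pi>1 V1 a)
      (\<lambda>(z, z'). convolution \<pi>1 \<pi> (ptrace \<pi>1 V1 \<pi>1 (R1 z)) (ptrace \<pi> V \<pi>2 (C z')) a b)
      (\<lambda>(z, z'). convolution \<pi> \<pi>2 (ptrace \<pi> V \<pi>2 (C z')) (ptrace \<pi>2 V2 \<pi>2 (R2 z)) a b)"
    unfolding mero_eq_def
  proof
    fix x assume x: "x \<in> loop_space \<pi>1 V1 a"
    let ?X = "\<lambda>i. otimes3 x (lvec V1 i) (rvec V i)"
    define P where "P = (\<lambda>(z, w).
      (\<forall>i\<in>?I. op12 (C w) (op23 (C z) (op12 (R1 (z - w)) (?X i))) =
              op23 (R2 (z - w)) (op12 (C z) (op23 (C w) (?X i)))) \<and>
      (\<forall>i\<in>?I. E w (C w (basis_tensor V1 V i)) = basis_tensor V1 V i) \<and>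
      (\<forall>k\<in>?J. C w (E w (basis_tensor V V2 k)) = basis_tensor V V2 k))"
    have "generically (\<lambda>w. \<forall>i\<in>?I. E w (C w (basis_tensor V1 V i)) = basis_tensor V1 V i)"
      using EC basis_tensor_in_string_space string_space_tensor2 unfolding mero_eq_def
      by (intro generically_ball_finite finite_basis_strings[OF V1 V]) fastforce
    moreover have "generically (\<lambda>w. \<forall>k\<in>?J. C w (E w (basis_tensor V V2 k)) = basis_tensor V V2 k)"
      using CE basis_tensor_in_string_space string_space_tensor2 unfolding mero_eq_def
      by (intro generically_ball_finite finite_basis_strings[OF V V2]) fastforce
    moreover have "generically (\<lambda>p. \<forall>i\<in>?I.
        op12 (C (snd p)) (op23 (C (fst p)) (op12 (R1 (fst p - snd p)) (?X i))) =
        op23 (R2 (fst p - snd p)) (op12 (C (fst p)) (op23 (C (snd p)) (?X i))))"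
    proof (rule generically_ball_finite)
      show "finite ?I" by (rule finite_basis_strings[OF V1 V])
      fix i assume "i \<in> ?I"
      then have "?X i \<in> tensor3 \<pi>1 V1 \<pi>1 V1 \<pi> V"
        by (rule basis_vecs) (rule otimes3_in_tensor3[OF x[unfolded loop_space_eq]])
      then show "generically (\<lambda>p. op12 (C (snd p)) (op23 (C (fst p)) (op12 (R1 (fst p - snd p)) (?X i))) =
        op23 (R2 (fst p - snd p)) (op12 (C (fst p)) (op23 (C (snd p)) (?X i))))"
        using inter unfolding mero_eq_def by (auto simp: split_def)
    qed
    ultimately have "generically (\<lambda>p. P p)"
      unfolding P_def split_def by (intro generically_conj generically_snd)
    \<comment> \<open>The operators \<open>C\<close> and \<open>R1\<close> are to appear at \<open>z'\<close> and \<open>z\<close>, so the relation is used at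
      \<open>(z', w)\<close> with \<open>z' - w = z\<close>.\<close>
    then have "generically (\<lambda>p. P (snd p, snd p - fst p))"
      by (rule generically_homeomorphism[where h' = "\<lambda>p. (fst p - snd p, fst p)"])
        (auto intro!: continuous_intros)
    then show "generically (\<lambda>p. (case p of (z, z') \<Rightarrow>
           convolution \<pi>1 \<pi> (ptrace \<pi>1 V1 \<pi>1 (R1 z)) (ptrace \<pi> V \<pi>2 (C z')) a b) x =
        (case p of (z, z') \<Rightarrow>
           convolution \<pi> \<pi>2 (ptrace \<pi> V \<pi>2 (C z')) (ptrace \<pi>2 V2 \<pi>2 (R2 z)) a b) x)"
    proof (rule generically_mono)
      fix p assume p: "P (snd p, snd p - fst p)"
      have "convolution \<pi>1 \<pi> (ptrace \<pi>1 V1 \<pi>1 (R1 (fst p))) (ptrace \<pi> V \<pi>2 (C (snd p))) a b x =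
          convolution \<pi> \<pi>2 (ptrace \<pi> V \<pi>2 (C (snd p))) (ptrace \<pi>2 V2 \<pi>2 (R2 (fst p))) a b x"
        by (rule convolution_commute[where D = "C (snd p - fst p)" and E = "E (snd p - fst p)", OF V1 V2 V R1 R2 C C E x])
          (use p in \<open>auto simp: P_def\<close>)
      then show "(case p of (z, z') \<Rightarrow>
           convolution \<pi>1 \<pi> (ptrace \<pi>1 V1 \<pi>1 (R1 z)) (ptrace \<pi> V \<pi>2 (C z')) a b) x =
        (case p of (z, z') \<Rightarrow>
           convolution \<pi> \<pi>2 (ptrace \<pi> V \<pi>2 (C z')) (ptrace \<pi>2 V2 \<pi>2 (R2 z)) a b) x"
        by (simp add: split_def)
    qed
  qed
qed

end
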